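(* Fix constants $h>0$, $c>0$, $\mu>0$. For $\lambda>0$ consider the problem of minimizing $\Pi_\lambda(s)=h\,\mathbb{E}Q_\lambda(s)+c\,s$ over integers $s$ with $s>\lambda/\mu$, where $\mathbb{E}Q_\lambda(s)$ is the expected steady-state queue length of the $M/M/s$ queue with arrival rate $\lambda$ and service rate $\mu$, and let $\Pi_\lambda^\star$ be its optimal value. Let $$q(\sigma)=\frac{1}{\sigma\left(1+\sigma\,\Phi(\sigma)/\phi(\sigma)\right)},\qquad \sigma>0,$$ where $\phi,\Phi$ are the standard normal density and distribution function, let $\sigma^\star$ be the (unique) minimizer of $h\,q(\sigma)+c\,\sigma$ over $\sigma>0$, and let $$\bar s_\lambda=\frac{\lambda}{\mu}+\sigma^\star\sqrt{\frac{\lambda}{\mu}}.$$ Then for every real-valued function $\eta_\lambda$ of $\lambda$ with $\eta_\lambda=o(\lambda^{1/4})$ as $\lambda\to\infty$, the staffing level $\bar s_\lambda+\eta_\lambda$ is $o(1)$-optimal, i.e. $$\lim_{\lambda\to\infty}\left(\Pi_\lambda(\bar s_\lambda+\eta_\lambda)-\Pi_\lambda^\star\right)=0.$$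
   Context: For an $M/M/s$ queue with arrival rate $\lambda$, service rate $\mu$ per server (mean service time $1/\mu$), $s$ servers, utilization $\rho=\lambda/(s\mu)<1$, the expected steady-state queue length (number waiting) is $$\mathbb{E}Q_\lambda(s)=\frac{\lambda}{s\mu-\lambda}\,B(\rho,s),$$ where $B(\rho,s)$ is the steady-state probability that all servers are busy. For integer $s$, $B(\rho,s)=\dfrac{\frac{(s\rho)^s}{s!(1-\rho)}}{\frac{(s\rho)^s}{s!(1-\rho)}+\sum_{k=0}^{s-1}\frac{(s\rho)^k}{k!}}$. This is extended to all real $s>\lambda/\mu$ by $$B(\rho,s)=\left[s\rho\int_0^\infty t\,e^{-s\rho t}(1+t)^{s-1}\,dt\right]^{-1},$$ and accordingly $\mathbb{E}Q_\lambda(s)$ and $\Pi_\lambda(s)$ are defined for all real $s>\lambda/\mu$ (so $\Pi_\lambda(\bar s_\lambda+\eta_\lambda)$ makes sense for all large $\lambda$). The condition $s>\lambda/\mu$ is the stability condition (the cost is infinite otherwise). *)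

theory Defs
  imports "HOL-Probability.Probability" "HOL-Library.Landau_Symbols"
begin

text \<open>
  The number of customers in an M/M/s system is a birth-death process on the naturals with birth
  rate \<open>lam\<close> and death rate \<open>min n s * mu\<close> in state \<open>n\<close>. A distribution is stationary if it solves
  the global balance equations (flow out of state \<open>n\<close> equals flow into state \<open>n\<close>).
\<close>

definition mms_stationary :: "real \<Rightarrow> real \<Rightarrow> nat \<Rightarrow> nat pmf \<Rightarrow> bool" where
  "mms_stationary lam mu s p \<longleftrightarrow>
     (\<forall>n. pmf p n * (lam + real (min n s) * mu) =
          (if n = 0 then 0 else pmf p (n - 1) * lam) +
          pmf p (Suc n) * (real (min (Suc n) s) * mu))"

text \<open>The stationary distribution exists and is unique when \<open>0 < lam < s * mu\<close>.\<close>

definition mms_steady_state :: "real \<Rightarrow> real \<Rightarrow> nat \<Rightarrow> nat pmf" where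
  "mms_steady_state lam mu s = (THE p. mms_stationary lam mu s p)"

text \<open>
  With \<open>n\<close> customers in the system, \<open>n - s\<close> (truncated subtraction) are waiting.
\<close>

definition mms_queue_length :: "real \<Rightarrow> real \<Rightarrow> nat \<Rightarrow> real" where
  "mms_queue_length lam mu s =
     measure_pmf.expectation (mms_steady_state lam mu s) (\<lambda>n. real (n - s))"

text \<open>
  Extension of the probability that all servers are busy (the Erlang C formula) and of the
  expected queue length to a real number \<open>s > lam / mu\<close> of servers. At integers these agree with
  the steady-state quantities of the M/M/s queue.
\<close>

definition busy_prob :: "real \<Rightarrow> real \<Rightarrow> real" where
  "busy_prob rho s =
     inverse (s * rho * (LBINT t:{0..}. t * exp (- (s * rho * t)) * (1 + t) powr (s - 1)))"

definition queue_length :: "real \<Rightarrow> real \<Rightarrow> real \<Rightarrow> real" where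
  "queue_length lam mu s = lam / (s * mu - lam) * busy_prob (lam / (s * mu)) s"

definition cost :: "real \<Rightarrow> real \<Rightarrow> real \<Rightarrow> real \<Rightarrow> real \<Rightarrow> real" where
  "cost h c mu lam s = h * queue_length lam mu s + c * s"

text \<open>
  The integer problem is stated for the queue itself. As \<open>lam / mu > 0\<close>, the feasible integers are
  natural numbers.
\<close>

definition optimal_cost :: "real \<Rightarrow> real \<Rightarrow> real \<Rightarrow> real \<Rightarrow> real" where
  "optimal_cost h c mu lam =
     (INF s\<in>{s :: nat. real s > lam / mu}. h * mms_queue_length lam mu s + c * real s)"

definition q :: "real \<Rightarrow> real" where
  "q \<sigma> = 1 / (\<sigma> * (1 + \<sigma> * cdf std_normal_distribution \<sigma> / std_normal_density \<sigma>))"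

definition is_sigma_star :: "real \<Rightarrow> real \<Rightarrow> real \<Rightarrow> bool" where
  "is_sigma_star h c = is_arg_min (\<lambda>\<sigma>. h * q \<sigma> + c * \<sigma>) (\<lambda>\<sigma>. \<sigma> > 0)"

definition sigma_star :: "real \<Rightarrow> real \<Rightarrow> real" where
  "sigma_star h c = (THE \<sigma>. is_sigma_star h c \<sigma>)"

definition s_bar :: "real \<Rightarrow> real \<Rightarrow> real \<Rightarrow> real \<Rightarrow> real" where
  "s_bar h c mu lam = lam / mu + sigma_star h c * sqrt (lam / mu)"

end

theory Submission
  imports Defs "HOL-Real_Asymp.Real_Asymp"
begin

text \<open>
  Write \<open>r = sqrt (lam / mu)\<close> and \<open>s = r\<^sup>2 + \<sigma> * r\<close>. The substitution \<open>t = u / r\<close> in the integral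
  that defines the busy probability turns the cost into \<open>c * r\<^sup>2 + r * scaled_cost h c r \<sigma>\<close>, where
  \<open>scaled_cost h c r \<sigma> = h / (\<sigma> * pre_integral r \<sigma>) + c * \<sigma>\<close> (\<open>cost_eq_scaled_cost\<close>). As \<open>r\<close> grows, the
  integrand of \<open>pre_integral r \<sigma>\<close> tends to \<open>u * exp (\<sigma> * u - u\<^sup>2 / 2)\<close>, whose integral is
  \<open>1 + \<sigma> * \<Phi> \<sigma> / \<phi> \<sigma>\<close>; so \<open>scaled_cost h c r\<close> tends to \<open>h * q \<sigma> + c * \<sigma>\<close>.

  Since the scaled cost is multiplied by \<open>r\<close>, its limit alone determines the cost only up to \<open>o(r)\<close>.
  The proof therefore needs one further term: by dominated convergence,
  \<open>r * (pre_integral r \<sigma> - lim_integral \<sigma>)\<close> has a limit, depending only on \<open>\<tau>\<close>, whenever \<open>\<sigma>\<close>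
  varies with \<open>r\<close> and tends to \<open>\<tau>\<close> (\<open>pre_integral_expansion\<close>). Two staffing levels with
  the same limit \<open>\<tau>\<close> have the same correction, which cancels in the difference of their costs. What remains is \<open>r\<close> times the difference of the limiting
  costs. For \<open>\<sigma> = \<tau> + \<delta> / r\<close> with \<open>\<tau>\<close> the minimizer of the limiting cost, this is
  \<open>r * O((\<delta> / r)\<^sup>2) = O(\<delta>\<^sup>2 / r)\<close> (\<open>limit_cost_quadratic\<close>), which vanishes if
  \<open>\<delta> = o(sqrt r) = o(lam powr (1/4))\<close>. Rounding up to an integer is such a perturbation.

  For the comparison with the optimum, choose for every arrival rate an integer staffing level whose
  cost is within a vanishing error of the optimal cost. Rescaled, these levels tend to \<open>\<tau>\<close>: they are
  bounded, none of their subsequences can tend to \<open>0\<close>, where \<open>q\<close> blows up, and any other cluster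
  point minimizes the limiting cost, so that it equals \<open>\<tau>\<close> (\<open>near_minimizers_converge\<close>). They
  therefore have the same correction term, and their limiting cost is at least that of \<open>\<tau>\<close>.

  Uniqueness of \<open>\<tau>\<close> rests on strict convexity of \<open>q\<close> (\<open>ddq_pos\<close>), and the integer problem is linked
  to the integral formula by computing the stationary distribution
  (\<open>mms_queue_length_eq_queue_length\<close>).
\<close>

section \<open>The M/M/s queue with an integer number of servers\<close>

text \<open>
  The stationary probabilities up to normalization, with \<open>a = lam / mu\<close>: Poisson weights while
  servers are free, a geometric tail with ratio \<open>a / s\<close> once all are busy.
\<close>

definition mms_weight :: "real \<Rightarrow> nat \<Rightarrow> nat \<Rightarrow> real" where
  "mms_weight a s n = (if n \<le> s then a ^ n / fact n else a ^ s / fact s * (a / real s) ^ (n - s))"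

definition mms_total :: "real \<Rightarrow> nat \<Rightarrow> real" where
  "mms_total a s = (\<Sum>k<s. a ^ k / fact k) + a ^ s / fact s * (1 / (1 - a / real s))"

lemma mms_weight_rec:
  assumes "s > 0"
  shows "mms_weight a s (Suc n) * real (min (Suc n) s) = mms_weight a s n * a"
proof (cases "n < s")
  case True
  have "a ^ Suc n / fact (Suc n) * real (Suc n) = a ^ n / fact n * a"
  proof -
    have "fact (Suc n) = real (Suc n) * fact n" by simp
    then show ?thesis by (simp add: divide_simps del: of_nat_Suc fact_Suc)
  qed
  then show ?thesis using True by (simp add: mms_weight_def min_def)
next
  case False
  then have "Suc n - s = Suc (n - s)" by simp
  moreover have "n = s \<Longrightarrow> mms_weight a s n = a ^ s / fact s * (a / real s) ^ (n - s)"
    by (simp add: mms_weight_def)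
  ultimately show ?thesis using False assms
    by (cases "n = s") (auto simp: mms_weight_def min_def)
qed

lemma mms_weight_shift: "mms_weight a s (n + s) = a ^ s / fact s * (a / real s) ^ n"
  by (auto simp: mms_weight_def)

lemma mms_weight_nonneg: "a > 0 \<Longrightarrow> mms_weight a s n \<ge> 0"
  by (auto simp: mms_weight_def)

lemma mms_weight_sums:
  assumes "a > 0" "a < real s"
  shows "mms_weight a s sums mms_total a s"
proof -
  have "(\<lambda>n. a ^ s / fact s * (a / real s) ^ n) sums (a ^ s / fact s * (1 / (1 - a / real s)))"
    using assms by (intro sums_mult geometric_sums) auto
  then have "(\<lambda>n. mms_weight a s (n + s)) sums (a ^ s / fact s * (1 / (1 - a / real s)))"
    by (simp add: mms_weight_shift)
  then have "mms_weight a s sums (a ^ s / fact s * (1 / (1 - a / real s)) + (\<Sum>k<s. mms_weight a s k))"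
    by (subst (asm) sums_iff_shift) 
  moreover have "(\<Sum>k<s. mms_weight a s k) = (\<Sum>k<s. a ^ k / fact k)"
    by (intro sum.cong) (auto simp: mms_weight_def)
  ultimately show ?thesis by (simp add: mms_total_def add.commute)
qed

lemma mms_total_pos:
  assumes "a > 0" "a < real s"
  shows "mms_total a s > 0"
proof -
  have "(\<Sum>k<s. a ^ k / fact k) \<ge> 0" using assms by (intro sum_nonneg) auto
  moreover have "a ^ s / fact s * (1 / (1 - a / real s)) > 0" using assms by simp
  ultimately show ?thesis unfolding mms_total_def by linarith
qed

lemma mms_waiting_sums:
  assumes "a > 0" "a < real s"
  shows "(\<lambda>n. real (n - s) * mms_weight a s n) sums
    (a ^ s / fact s * ((a / real s) / (1 - a / real s)\<^sup>2))"
proof -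
  define \<rho> where "\<rho> = a / real s"
  have \<rho>: "norm \<rho> < 1" using assms by (simp add: \<rho>_def)
  have "(\<lambda>n. \<rho> * (of_nat (Suc n) * \<rho> ^ n)) sums (\<rho> * (1 / (1 - \<rho>)\<^sup>2))"
    by (intro sums_mult geometric_deriv_sums \<rho>)
  then have "(\<lambda>n. (\<lambda>m. real m * \<rho> ^ m) (Suc n)) sums (\<rho> / (1 - \<rho>)\<^sup>2)" by (simp add: mult_ac)
  then have "(\<lambda>m. real m * \<rho> ^ m) sums (\<rho> / (1 - \<rho>)\<^sup>2)" by (subst (asm) sums_Suc_iff) simp
  then have "(\<lambda>m. a ^ s / fact s * (real m * \<rho> ^ m)) sums (a ^ s / fact s * (\<rho> / (1 - \<rho>)\<^sup>2))"
    by (rule sums_mult)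
  then have "(\<lambda>m. (\<lambda>n. real (n - s) * mms_weight a s n) (m + s)) sums (a ^ s / fact s * (\<rho> / (1 - \<rho>)\<^sup>2))"
    by (simp add: mms_weight_shift \<rho>_def mult_ac)
  then have "(\<lambda>n. real (n - s) * mms_weight a s n) sums
      (a ^ s / fact s * (\<rho> / (1 - \<rho>)\<^sup>2) + (\<Sum>n<s. real (n - s) * mms_weight a s n))"
    by (subst (asm) sums_iff_shift)
  then show ?thesis by (simp add: \<rho>_def)
qed

text \<open>
  Summing the global balance equations over the states \<open>0, \<dots>, n\<close> shows that the flow from \<open>n\<close> to
  \<open>n + 1\<close> equals the flow back. This first-order recurrence determines the distribution up to its
  value at \<open>0\<close>.
\<close>

lemma mms_stationary_iff:
  assumes lam: "lam > 0" and mu: "mu > 0" and s: "s > 0"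
  shows "mms_stationary lam mu s p \<longleftrightarrow> (\<forall>n. pmf p n = pmf p 0 * mms_weight (lam / mu) s n)"
proof
  assume st: "mms_stationary lam mu s p"
  have flow: "pmf p n * lam = pmf p (Suc n) * (real (min (Suc n) s) * mu)" for n
  proof (induction n)
    case 0
    show ?case using st[unfolded mms_stationary_def, rule_format, of 0] by simp
  next
    case (Suc n)
    show ?case using st[unfolded mms_stationary_def, rule_format, of "Suc n"] Suc
      by (simp add: distrib_left)
  qed
  show "\<forall>n. pmf p n = pmf p 0 * mms_weight (lam / mu) s n"
  proof
    fix n show "pmf p n = pmf p 0 * mms_weight (lam / mu) s n"
    proof (induction n)
      case 0 show ?case by (simp add: mms_weight_def)
    next
      case (Suc n)
      have nz: "real (min (Suc n) s) * mu \<noteq> 0" using s mu by simp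
      have "pmf p (Suc n) * (real (min (Suc n) s) * mu) = pmf p 0 * (mms_weight (lam / mu) s n * (lam / mu)) * mu"
        using flow[of n] Suc mu by simp
      also have "\<dots> = pmf p 0 * mms_weight (lam / mu) s (Suc n) * (real (min (Suc n) s) * mu)"
        unfolding mms_weight_rec[OF s, symmetric] by (simp only: mult_ac)
      finally show ?case unfolding mult_right_cancel[OF nz] .
    qed
  qed
next
  assume *: "\<forall>n. pmf p n = pmf p 0 * mms_weight (lam / mu) s n"
  have flow: "pmf p n * lam = pmf p (Suc n) * (real (min (Suc n) s) * mu)" for n
  proof -
    have "pmf p (Suc n) * (real (min (Suc n) s) * mu)
        = pmf p 0 * (mms_weight (lam / mu) s (Suc n) * real (min (Suc n) s)) * mu"
      unfolding *[rule_format, of "Suc n"] by (simp only: mult_ac)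
    also have "\<dots> = pmf p 0 * mms_weight (lam / mu) s n * lam"
      unfolding mms_weight_rec[OF s] using mu by simp
    also have "\<dots> = pmf p n * lam" by (simp only: *[rule_format, of n])
    finally show ?thesis ..
  qed
  show "mms_stationary lam mu s p" unfolding mms_stationary_def
  proof
    fix n
    show "pmf p n * (lam + real (min n s) * mu) =
          (if n = 0 then 0 else pmf p (n - 1) * lam) +
          pmf p (Suc n) * (real (min (Suc n) s) * mu)"
      using flow[of n] flow[of "n - 1"] by (cases n) (simp_all add: distrib_left)
  qed
qed

lemma pmf_nat_sums_1: "pmf (p :: nat pmf) sums 1"
  using sums_integral_count_space_nat[of "pmf p"] integral_pmf[where M = p and X = UNIV] integrable_pmf[where M = p and X = UNIV] by simp

lemma mms_stationary_unique:
  assumes lam: "lam > 0" and mu: "mu > 0" and s: "lam / mu < real s"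
  shows "\<exists>!p. mms_stationary lam mu s p"
    and "pmf (mms_steady_state lam mu s) n = mms_weight (lam / mu) s n / mms_total (lam / mu) s"
proof -
  define a where "a = lam / mu"
  have a: "a > 0" "a < real s" using lam mu s by (auto simp: a_def)
  then have s0: "s > 0" by (cases s) auto
  let ?f = "\<lambda>n. mms_weight a s n / mms_total a s"
  have f0: "?f n \<ge> 0" for n using mms_weight_nonneg[OF a(1)] mms_total_pos[OF a] by simp
  have f1: "?f sums 1"
    using sums_divide[OF mms_weight_sums[OF a], of "mms_total a s"] mms_total_pos[OF a] by simp
  have f2: "(\<integral>\<^sup>+ n. ennreal (?f n) \<partial>count_space UNIV) = 1"
    using f1 by (simp add: nn_integral_count_space_nat suminf_ennreal2[OF f0] sums_iff)
  define p where "p = embed_pmf ?f"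
  have p: "pmf p n = ?f n" for n unfolding p_def by (rule pmf_embed_pmf[OF f0 f2])
  have uniq: "pmf p' n = ?f n" if "mms_stationary lam mu s p'" for p' n
  proof -
    have *: "pmf p' n = pmf p' 0 * mms_weight a s n" for n
      using that unfolding mms_stationary_iff[OF lam mu s0] a_def by blast
    have "(\<lambda>n. pmf p' 0 * mms_weight a s n) sums (pmf p' 0 * mms_total a s)"
      by (intro sums_mult mms_weight_sums a)
    moreover have "pmf p' = (\<lambda>n. pmf p' 0 * mms_weight a s n)" by (rule ext) (rule *)
    ultimately have "pmf p' sums (pmf p' 0 * mms_total a s)" by metis
    then have "pmf p' 0 * mms_total a s = 1" using pmf_nat_sums_1[of p'] sums_unique2 by blast
    then have "pmf p' 0 = 1 / mms_total a s" using mms_total_pos[OF a] by (simp add: field_simps)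
    then show ?thesis using *[of n] by simp
  qed
  have st: "mms_stationary lam mu s p"
    unfolding mms_stationary_iff[OF lam mu s0] by (simp add: p flip: a_def) (simp add: mms_weight_def)
  show ex: "\<exists>!p. mms_stationary lam mu s p"
  proof (rule ex1I[of "mms_stationary lam mu s", OF st])
    fix p' assume "mms_stationary lam mu s p'"
    then show "p' = p" by (intro pmf_eqI) (simp add: uniq p)
  qed
  from theI'[OF ex] show "pmf (mms_steady_state lam mu s) n = mms_weight (lam / mu) s n / mms_total (lam / mu) s"
    unfolding mms_steady_state_def a_def[symmetric] by (rule uniq)
qed

lemma mms_queue_length_eq:
  assumes lam: "lam > 0" and mu: "mu > 0" and s: "lam / mu < real s"
  defines "a \<equiv> lam / mu"
  shows "mms_queue_length lam mu s =
    a ^ s / fact s * ((a / real s) / (1 - a / real s)\<^sup>2) / mms_total a s"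
proof -
  have a: "a > 0" "a < real s" using lam mu s by (auto simp: a_def)
  let ?p = "mms_steady_state lam mu s"
  let ?v = "a ^ s / fact s * ((a / real s) / (1 - a / real s)\<^sup>2) / mms_total a s"
  have "(\<lambda>n. real (n - s) * mms_weight a s n / mms_total a s) sums ?v"
    by (intro sums_divide mms_waiting_sums a)
  then have *: "(\<lambda>n. pmf ?p n * real (n - s)) sums ?v"
    unfolding mms_stationary_unique(2)[OF lam mu s] a_def by (simp add: mult_ac)
  have "mms_queue_length lam mu s = (\<integral>n. pmf ?p n * real (n - s) \<partial>count_space UNIV)"
    unfolding mms_queue_length_def measure_pmf_eq_density by (subst integral_density) auto
  also have "\<dots> = ?v"
  proof -
    have "integrable (count_space UNIV) (\<lambda>n. pmf ?p n * real (n - s))"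
      using * by (simp add: integrable_count_space_nat_iff sums_iff)
    then show ?thesis using * by (simp add: integral_count_space_nat sums_iff)
  qed
  finally show ?thesis .
qed

text \<open>
  Repeated integration by parts gives an explicit antiderivative.
\<close>

lemma exp_power_integral:
  fixes a :: real
  assumes a: "a > 0"
  shows "has_bochner_integral lborel (\<lambda>t. indicator {0..} t *\<^sub>R (exp (- (a * t)) * (1 + t) ^ n))
    (fact n / a ^ Suc n * (\<Sum>k\<le>n. a ^ k / fact k))"
proof -
  \<comment> \<open>The antiderivative; it vanishes at infinity, so the integral is its value at 0 with the sign changed.\<close>
  define G where "G = (\<lambda>n t. - exp (- (a * t)) * (\<Sum>k\<le>n. fact n / (fact k * a ^ (Suc n - k)) * (1 + t) ^ k))"
  have G_Suc: "G (Suc n) t = real (Suc n) / a * G n t - exp (- (a * t)) * (1 + t) ^ Suc n / a" for n t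
  proof -
    have "(\<Sum>k\<le>Suc n. fact (Suc n) / (fact k * a ^ (Suc (Suc n) - k)) * (1 + t) ^ k)
      = real (Suc n) / a * (\<Sum>k\<le>n. fact n / (fact k * a ^ (Suc n - k)) * (1 + t) ^ k) + (1 + t) ^ Suc n / a"
      unfolding sum_distrib_left sum.atMost_Suc
    proof (intro arg_cong2[where f = "(+)"] sum.cong refl)
      fix k assume "k \<in> {..n}"
      then show "fact (Suc n) / (fact k * a ^ (Suc (Suc n) - k)) * (1 + t) ^ k =
          real (Suc n) / a * (fact n / (fact k * a ^ (Suc n - k)) * (1 + t) ^ k)"
        using a by (simp add: Suc_diff_le mult_ac)
    next
      show "fact (Suc n) / (fact (Suc n) * a ^ (Suc (Suc n) - Suc n)) * (1 + t) ^ Suc n = (1 + t) ^ Suc n / a"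
        by (simp del: fact_Suc power_Suc add: power_one_right)
    qed
    then have "G (Suc n) t = - exp (- (a * t)) *
        (real (Suc n) / a * (\<Sum>k\<le>n. fact n / (fact k * a ^ (Suc n - k)) * (1 + t) ^ k) + (1 + t) ^ Suc n / a)"
      by (simp only: G_def)
    then show ?thesis unfolding G_def by (simp only: distrib_left) simp
  qed
  have deriv: "(G n has_real_derivative exp (- (a * t)) * (1 + t) ^ n) (at t)" for n t
  proof (induction n)
    case 0
    show ?case unfolding G_def using a by (auto intro!: derivative_eq_intros)
  next
    case (Suc n)
    have "((\<lambda>t. real (Suc n) / a * G n t - exp (- (a * t)) * (1 + t) ^ Suc n / a)
        has_real_derivative exp (- (a * t)) * (1 + t) ^ Suc n) (at t)"
      using a by (auto intro!: derivative_eq_intros Suc.IH simp: field_simps simp del: power_Suc)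
    then show ?case unfolding G_Suc[symmetric] .
  qed
  have lim: "((\<lambda>t. G n t) \<longlongrightarrow> 0) at_top"
  proof -
    have "((\<lambda>t. exp (- (a * t)) * (1 + t) ^ k) \<longlongrightarrow> 0) at_top" for k
      using a by real_asymp
    then have "((\<lambda>t. - (\<Sum>k\<le>n. fact n / (fact k * a ^ (Suc n - k)) * (exp (- (a * t)) * (1 + t) ^ k))) \<longlongrightarrow>
        - (\<Sum>k\<le>n. fact n / (fact k * a ^ (Suc n - k)) * 0)) at_top"
      by (intro tendsto_intros)
    then show ?thesis by (simp add: G_def sum_distrib_left mult_ac flip: sum_negf)
  qed
  have "(\<integral>\<^sup>+ t. ennreal (exp (- (a * t)) * (1 + t) ^ n) * indicator {0..} t \<partial>lborel) = ennreal (0 - G n 0)"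
    by (rule nn_integral_FTC_atLeast[OF _ deriv _ lim]) auto
  also have "0 - G n 0 = fact n / a ^ Suc n * (\<Sum>k\<le>n. a ^ k / fact k)"
  proof -
    have "(\<Sum>k\<le>n. fact n / (fact k * a ^ (Suc n - k))) = (\<Sum>k\<le>n. fact n / a ^ Suc n * (a ^ k / fact k))"
    proof (intro sum.cong refl)
      fix k assume "k \<in> {..n}"
      then have "a ^ Suc n = a ^ k * a ^ (Suc n - k)" by (simp flip: power_add)
      then show "fact n / (fact k * a ^ (Suc n - k)) = fact n / a ^ Suc n * (a ^ k / fact k)"
        using a by (simp add: field_simps)
    qed
    then show ?thesis by (simp add: G_def sum_distrib_left sum_negf)
  qed
  finally have *: "(\<integral>\<^sup>+ t. ennreal (exp (- (a * t)) * (1 + t) ^ n) * indicator {0..} t \<partial>lborel) =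
      ennreal (fact n / a ^ Suc n * (\<Sum>k\<le>n. a ^ k / fact k))" .
  show ?thesis
  proof (rule has_bochner_integral_nn_integral)
    have "(\<integral>\<^sup>+ t. ennreal (indicator {0..} t *\<^sub>R (exp (- (a * t)) * (1 + t) ^ n)) \<partial>lborel)
      = (\<integral>\<^sup>+ t. ennreal (exp (- (a * t)) * (1 + t) ^ n) * indicator {0..} t \<partial>lborel)"
      by (intro nn_integral_cong) (simp split: split_indicator)
    with * show "(\<integral>\<^sup>+ t. ennreal (indicator {0..} t *\<^sub>R (exp (- (a * t)) * (1 + t) ^ n)) \<partial>lborel)
      = ennreal (fact n / a ^ Suc n * (\<Sum>k\<le>n. a ^ k / fact k))" by simp
    show "AE t in lborel. 0 \<le> indicator {0..} t *\<^sub>R (exp (- (a * t)) * (1 + t) ^ n)"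
      by (intro AE_I2) (simp split: split_indicator)
    show "0 \<le> fact n / a ^ Suc n * (\<Sum>k\<le>n. a ^ k / fact k)"
      using a by (intro mult_nonneg_nonneg sum_nonneg) auto
  qed measurable
qed

text \<open>
  The factor \<open>t\<close> in the integrand is \<open>(1 + t) - 1\<close>, so the integral is a difference of two
  integrals of the form above; multiplied by \<open>a\<close>, this difference is the reciprocal of the
  Erlang C formula.
\<close>

lemma busy_prob_nat:
  assumes a: "a > 0" "a < real s"
  shows "busy_prob (a / real s) (real s) = a ^ s / fact s * (1 / (1 - a / real s)) / mms_total a s"
proof -
  obtain m where m: "s = Suc m" using a by (cases s) auto
  let ?T = "\<lambda>n. \<Sum>k\<le>n. a ^ k / fact k"
  let ?K = "\<lambda>n. fact n / a ^ Suc n * ?T n"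
  have "(LBINT t:{0..}. t * exp (- (a * t)) * (1 + t) powr (real s - 1))
      = (\<integral>t. indicator {0..} t *\<^sub>R (exp (- (a * t)) * (1 + t) ^ Suc m) -
           indicator {0..} t *\<^sub>R (exp (- (a * t)) * (1 + t) ^ m) \<partial>lborel)"
    unfolding set_lebesgue_integral_def
    by (intro Bochner_Integration.integral_cong refl)
      (auto simp: indicator_def m powr_realpow algebra_simps)
  also have "\<dots> = ?K (Suc m) - ?K m"
    by (intro has_bochner_integral_integral_eq has_bochner_integral_diff exp_power_integral a)
  finally have I: "(LBINT t:{0..}. t * exp (- (a * t)) * (1 + t) powr (real s - 1)) = ?K (Suc m) - ?K m" .
  define P where "P = ?T m"
  have T: "?T (Suc m) = P + a ^ Suc m / fact (Suc m)" by (simp add: P_def)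
  have P: "P \<ge> 0" unfolding P_def using a by (intro sum_nonneg) auto
  have W: "mms_total a s = P + a ^ s / fact s * (1 / (1 - a / real s))"
    by (simp add: mms_total_def P_def m lessThan_Suc_atMost)
  define F where "F = a ^ s / fact s"
  have F: "F > 0" using a by (simp add: F_def)
  \<comment> \<open>The top term of \<open>?K (Suc m)\<close> contributes \<open>1\<close>; the others differ from those of \<open>?K m\<close> by the factor \<open>real s / a\<close>.\<close>
  have "a * (?K (Suc m) - ?K m) = 1 + (1 - a / real s) * P / F"
  proof -
    have "a * (fact (Suc m) / a ^ Suc (Suc m)) = 1 / F" and "a * (fact m / a ^ Suc m) = (a / real s) / F"
      unfolding F_def m using a by simp_all
    then have "a * (?K (Suc m) - ?K m) = 1 / F * ?T (Suc m) - (a / real s) / F * ?T m"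
      by (simp only: right_diff_distrib mult.assoc[symmetric])
    also have "\<dots> = 1 / F * (P + F) - (a / real s) / F * P"
      unfolding T F_def m P_def ..
    also have "\<dots> = 1 + (1 - a / real s) * P / F"
      using F by (simp add: diff_divide_distrib add_divide_distrib left_diff_distrib)
    finally show ?thesis .
  qed
  then have B: "busy_prob (a / real s) (real s) = inverse (1 + (1 - a / real s) * P / F)"
    unfolding busy_prob_def using I a by simp
  define d where "d = 1 - a / real s"
  have d: "d > 0" using a by (simp add: d_def)
  have "inverse (1 + d * P / F) = F * (1 / d) / (P + F * (1 / d))"
    using d F P by (simp add: field_simps add_pos_nonneg)
  then show ?thesis unfolding B W d_def F_def .
qed

text \<open>
  The integer problem may be analysed with the integral formula, which makes sense for all real
  \<open>s\<close>.
\<close>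

lemma mms_queue_length_eq_queue_length:
  assumes lam: "lam > 0" and mu: "mu > 0" and s: "lam / mu < real s"
  shows "mms_queue_length lam mu s = queue_length lam mu (real s)"
proof -
  define a where "a = lam / mu"
  have a: "a > 0" "a < real s" using lam mu s by (auto simp: a_def)
  have l: "lam = a * mu" using mu by (simp add: a_def)
  define d where "d = 1 - a / real s"
  have d: "d > 0" using a by (simp add: d_def)
  have 1: "lam / (real s * mu) = a / real s" using mu by (simp add: l)
  have 2: "lam / (real s * mu - lam) = (a / real s) / d" using mu a by (simp add: l d_def field_simps)
  show ?thesis
    unfolding mms_queue_length_eq[OF assms] queue_length_def 1 2 busy_prob_nat[OF a]
    unfolding a_def[symmetric] d_def[symmetric] by (simp add: power2_eq_square mult_ac)
qed

section \<open>The cost in square-root scaling\<close>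

text \<open>
  With \<open>s = r\<^sup>2 + \<sigma> * r\<close> and \<open>t = u / r\<close>, the factor \<open>exp (- (r\<^sup>2 * t)) * (1 + t) powr (s - 1)\<close> of the
  integrand is the exponential of \<open>pre_exponent r \<sigma> u\<close>; \<open>lim_exponent \<sigma> u\<close> is its limit for large
  \<open>r\<close>.
\<close>

definition pre_exponent :: "real \<Rightarrow> real \<Rightarrow> real \<Rightarrow> real" where
  "pre_exponent r \<sigma> u = - (r * u) + (r\<^sup>2 + \<sigma> * r - 1) * ln (1 + u / r)"

definition lim_exponent :: "real \<Rightarrow> real \<Rightarrow> real" where
  "lim_exponent \<sigma> u = \<sigma> * u - u\<^sup>2 / 2"

definition pre_integral :: "real \<Rightarrow> real \<Rightarrow> real" where
  "pre_integral r \<sigma> = (LBINT u:{0..}. u * exp (pre_exponent r \<sigma> u))"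

definition lim_integral :: "real \<Rightarrow> real" where
  "lim_integral \<sigma> = (LBINT u:{0..}. u * exp (lim_exponent \<sigma> u))"

text \<open>
  The polynomial factor is the limit of \<open>r * (pre_exponent r \<sigma> u - lim_exponent \<sigma> u)\<close>, so this is
  the coefficient of \<open>1 / r\<close> in the expansion of \<open>pre_integral r \<sigma>\<close>.
\<close>

definition corr_integral :: "real \<Rightarrow> real" where
  "corr_integral \<sigma> = (LBINT u:{0..}. u * (u ^ 3 / 3 - \<sigma> * u\<^sup>2 / 2 - u) * exp (lim_exponent \<sigma> u))"

lemma queue_length_eq_pre_integral:
  fixes r \<sigma> mu :: real
  assumes r: "r > 0" and \<sigma>: "\<sigma> > 0" and mu: "mu > 0"
  shows "queue_length (r\<^sup>2 * mu) mu (r\<^sup>2 + \<sigma> * r) = r / (\<sigma> * pre_integral r \<sigma>)"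
proof -
  define s where "s = r\<^sup>2 + \<sigma> * r"
  have s: "s > 0" using r \<sigma> by (simp add: s_def add_pos_pos)
  have a: "s * (r\<^sup>2 * mu / (s * mu)) = r\<^sup>2" using s mu by simp
  define g where "g = (\<lambda>t. indicator {0..} t *\<^sub>R (t * exp (- (r\<^sup>2 * t)) * (1 + t) powr (s - 1)) :: real)"
  have "integral\<^sup>L lborel g = (1 / r) * (\<integral>u. g (0 + (1 / r) * u) \<partial>lborel)"
    using r by (subst lborel_integral_real_affine[of "1 / r" _ 0]) auto
  also have "(\<integral>u. g (0 + (1 / r) * u) \<partial>lborel) = (\<integral>u. (1 / r) * (indicator {0..} u *\<^sub>R (u * exp (pre_exponent r \<sigma> u))) \<partial>lborel)"
  proof (intro Bochner_Integration.integral_cong refl)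
    fix u :: real
    show "g (0 + (1 / r) * u) = (1 / r) * (indicator {0..} u *\<^sub>R (u * exp (pre_exponent r \<sigma> u)))"
    proof (cases "u \<ge> 0")
      case True
      then have "(1 + u / r) powr (s - 1) = exp ((s - 1) * ln (1 + u / r))"
        using r by (auto simp: powr_def add_nonneg_eq_0_iff)
      then show ?thesis using True r
        by (simp add: g_def pre_exponent_def s_def power2_eq_square flip: exp_add)
    next
      case False
      then show ?thesis using r by (simp add: g_def field_simps)
    qed
  qed
  also have "\<dots> = (1 / r) * pre_integral r \<sigma>"
    by (simp add: pre_integral_def set_lebesgue_integral_def)
  finally have "r\<^sup>2 * (LBINT t:{0..}. t * exp (- (r\<^sup>2 * t)) * (1 + t) powr (s - 1)) = pre_integral r \<sigma>"
    using r by (simp add: g_def set_lebesgue_integral_def power2_eq_square)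
  then have "busy_prob (r\<^sup>2 * mu / (s * mu)) s = inverse (pre_integral r \<sigma>)"
    unfolding busy_prob_def a by simp
  moreover have "r\<^sup>2 * mu / (s * mu - r\<^sup>2 * mu) = r / \<sigma>"
    using r \<sigma> mu by (simp add: s_def field_simps power2_eq_square)
  ultimately show ?thesis unfolding queue_length_def s_def[symmetric] by (simp add: field_simps)
qed

definition scaled_cost :: "real \<Rightarrow> real \<Rightarrow> real \<Rightarrow> real \<Rightarrow> real" where
  "scaled_cost h c r \<sigma> = h / (\<sigma> * pre_integral r \<sigma>) + c * \<sigma>"

lemma cost_eq_scaled_cost:
  fixes r \<sigma> mu :: real
  assumes r: "r > 0" and \<sigma>: "\<sigma> > 0" and mu: "mu > 0"
  shows "cost h c mu (r\<^sup>2 * mu) (r\<^sup>2 + \<sigma> * r) = c * r\<^sup>2 + r * scaled_cost h c r \<sigma>"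
  unfolding scaled_cost_def cost_def queue_length_eq_pre_integral[OF assms] by (simp add: algebra_simps)

section \<open>First-order expansion of the scaled integral\<close>

lemma has_bochner_integral_power_exp:
  shows "has_bochner_integral lborel (\<lambda>u. indicator {0..} u *\<^sub>R (u ^ k * exp (- u))) (fact k :: real)"
proof (rule has_bochner_integral_nn_integral)
  have "(\<integral>\<^sup>+ u. ennreal (indicator {0..} u *\<^sub>R (u ^ k * exp (- u))) \<partial>lborel)
      = (\<integral>\<^sup>+ u. ennreal (u ^ k * exp (- u)) * indicator {0..} u \<partial>lborel)"
    by (intro nn_integral_cong) (simp split: split_indicator)
  then show "(\<integral>\<^sup>+ u. ennreal (indicator {0..} u *\<^sub>R (u ^ k * exp (- u))) \<partial>lborel) = ennreal (fact k)"
    by (simp add: nn_intergal_power_times_exp_Ici)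
  show "AE u in lborel. 0 \<le> indicator {0..} u *\<^sub>R (u ^ k * exp (- u) :: real)"
    by (intro AE_I2) (simp split: split_indicator)
  show "(0::real) \<le> fact k" by simp
qed measurable

text \<open>
  Unlike the Taylor bound of order three, this bound stays below \<open>x\<close> by an amount of order \<open>x\<close> for
  large \<open>x\<close>. This is what makes a domination over the whole half-line possible.
\<close>

lemma ln_one_plus_le:
  fixes x :: real
  assumes "x \<ge> 0"
  shows "ln (1 + x) \<le> x - x\<^sup>2 / (2 * (1 + x))"
proof -
  define f where "f = (\<lambda>x::real. x - x\<^sup>2 / (2 * (1 + x)) - ln (1 + x))"
  have "f 0 \<le> f x"
  proof (rule DERIV_nonneg_imp_nondecreasing[OF assms])
    fix y :: real assume y: "0 \<le> y" "y \<le> x"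
    have "(f has_real_derivative (y\<^sup>2 / (2 * (1 + y)\<^sup>2))) (at y)"
      unfolding f_def using y
      by (auto intro!: derivative_eq_intros) (simp add: divide_simps; algebra)
    moreover have "y\<^sup>2 / (2 * (1 + y)\<^sup>2) \<ge> 0" by simp
    ultimately show "\<exists>d. (f has_real_derivative d) (at y) \<and> 0 \<le> d" by blast
  qed
  then show ?thesis by (simp add: f_def)
qed

lemma ln_one_plus_ge:
  fixes x :: real
  assumes "x \<ge> 0"
  shows "x - x\<^sup>2 / 2 \<le> ln (1 + x)"
proof -
  define f where "f = (\<lambda>x::real. ln (1 + x) - x + x\<^sup>2 / 2)"
  have "f 0 \<le> f x"
  proof (rule DERIV_nonneg_imp_nondecreasing[OF assms])
    fix y :: real assume y: "0 \<le> y" "y \<le> x"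
    have "(f has_real_derivative (y\<^sup>2 / (1 + y))) (at y)"
      unfolding f_def using y
      by (auto intro!: derivative_eq_intros simp: divide_simps power2_eq_square) (auto simp: algebra_simps)
    moreover have "y\<^sup>2 / (1 + y) \<ge> 0" using y by simp
    ultimately show "\<exists>d. (f has_real_derivative d) (at y) \<and> 0 \<le> d" by blast
  qed
  then show ?thesis by (simp add: f_def)
qed

lemma ln_one_plus_le_cubic:
  fixes x :: real
  assumes "x \<ge> 0"
  shows "ln (1 + x) \<le> x - x\<^sup>2 / 2 + x ^ 3 / 3"
proof -
  define f where "f = (\<lambda>x::real. x - x\<^sup>2 / 2 + x ^ 3 / 3 - ln (1 + x))"
  have "f 0 \<le> f x"
  proof (rule DERIV_nonneg_imp_nondecreasing[OF assms])
    fix y :: real assume y: "0 \<le> y" "y \<le> x"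
    have "(f has_real_derivative (y ^ 3 / (1 + y))) (at y)"
      unfolding f_def using y
      by (auto intro!: derivative_eq_intros simp: divide_simps power2_eq_square power3_eq_cube) (auto simp: algebra_simps)
    moreover have "y ^ 3 / (1 + y) \<ge> 0" using y by simp
    ultimately show "\<exists>d. (f has_real_derivative d) (at y) \<and> 0 \<le> d" by blast
  qed
  then show ?thesis by (simp add: f_def)
qed

text \<open>
  For large \<open>r\<close> the exponent decays at least like \<open>-u\<close>, with constants that depend only on a bound
  for \<open>\<sigma>\<close>: quadratic decay as long as \<open>u\<close> is at most of order \<open>r\<close>, and beyond that linear decay
  with a slope of order \<open>r\<close>, large enough to absorb \<open>(\<sigma> + 1) * u\<close>.
\<close>

lemma pre_exponent_le:
  assumes S: "\<bar>\<sigma>\<bar> \<le> S" and r: "r \<ge> 4 * (S + 1)" and u: "u \<ge> 0"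
  shows "pre_exponent r \<sigma> u \<le> 4 * (S + 1)\<^sup>2 - u"
proof -
  \<comment> \<open>Beyond \<open>r0\<close> the decay \<open>r0 * u / 4\<close> offsets \<open>(S + 1) * u\<close>; up to \<open>r0\<close> the latter is at most \<open>(S + 1) * r0\<close>.\<close>
  define r0 where "r0 = 4 * (S + 1)"
  have S0: "S \<ge> 0" using S by linarith
  have r0: "r0 > 0" "r0 \<le> r" using S0 r by (auto simp: r0_def)
  have r1: "r > 0" using r0 by linarith
  define x where "x = u / r"
  have x: "x \<ge> 0" using u r1 by (simp add: x_def)
  have ux: "u = r * x" using r1 by (simp add: x_def)
  have ln0: "ln (1 + x) \<ge> 0" and lnx: "ln (1 + x) \<le> x" using x by (auto intro: ln_add_one_self_le_self)
  have "r\<^sup>2 * ln (1 + x) \<le> r\<^sup>2 * (x - x\<^sup>2 / (2 * (1 + x)))"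
    by (intro mult_left_mono ln_one_plus_le x) auto
  also have "\<dots> = r * u - r * u\<^sup>2 / (2 * (r + u))"
  proof -
    have "r\<^sup>2 * (x\<^sup>2 / (2 * (1 + x))) = r * (r * x)\<^sup>2 / (2 * (r * (1 + x)))"
      using r1 x by (simp add: power2_eq_square)
    then show ?thesis unfolding ux by (simp add: algebra_simps power2_eq_square)
  qed
  finally have 0: "r\<^sup>2 * ln (1 + x) \<le> r * u - r * u\<^sup>2 / (2 * (r + u))" .
  have "r * u\<^sup>2 / (2 * (r + u)) \<ge> r0 * u\<^sup>2 / (2 * (r0 + u))"
  proof -
    have "r0 / (r0 + u) \<le> r / (r + u)" using r0 r1 u by (simp add: field_simps mult_right_mono)
    then have "r0 / (r0 + u) * (u\<^sup>2 / 2) \<le> r / (r + u) * (u\<^sup>2 / 2)" by (intro mult_right_mono) auto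
    then show ?thesis by (simp add: field_simps)
  qed
  with 0 have 1: "r\<^sup>2 * ln (1 + x) \<le> r * u - r0 * u\<^sup>2 / (2 * (r0 + u))" by linarith
  have "\<sigma> * (r * ln (1 + x)) \<le> S * (r * ln (1 + x))"
    using S r1 ln0 by (intro mult_right_mono) auto
  also have "\<dots> \<le> S * u" unfolding ux using S0 r1 lnx by (intro mult_left_mono) auto
  finally have 2: "\<sigma> * (r * ln (1 + x)) \<le> S * u" .
  have 3: "(S + 1) * u - r0 * u\<^sup>2 / (2 * (r0 + u)) \<le> 4 * (S + 1)\<^sup>2"
  proof (cases "u \<ge> r0")
    case True
    have "r0 * u / 4 \<le> r0 * u\<^sup>2 / (2 * (r0 + u))" 
      using True r0 u by (simp add: field_simps power2_eq_square mult_left_mono)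
    moreover have "r0 * u / 4 = (S + 1) * u" by (simp add: r0_def)
    moreover have "4 * (S + 1)\<^sup>2 \<ge> 0" by simp
    ultimately show ?thesis by linarith
  next
    case False
    have "(S + 1) * u \<le> (S + 1) * r0" using False S0 by (intro mult_left_mono) auto
    also have "\<dots> = 4 * (S + 1)\<^sup>2" by (simp add: r0_def power2_eq_square)
    finally show ?thesis using r0 u by (smt (verit) divide_nonneg_nonneg mult_nonneg_nonneg zero_le_power2)
  qed
  have "pre_exponent r \<sigma> u = - (r * u) + r\<^sup>2 * ln (1 + x) + \<sigma> * (r * ln (1 + x)) - ln (1 + x)"
    by (simp add: pre_exponent_def x_def algebra_simps)
  with 1 2 3 ln0 show ?thesis by (simp add: algebra_simps)
qed

lemma lim_exponent_le:
  assumes S: "\<bar>\<sigma>\<bar> \<le> S" and u: "u \<ge> 0"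
  shows "lim_exponent \<sigma> u \<le> 4 * (S + 1)\<^sup>2 - u"
proof -
  have "\<sigma> * u \<le> S * u" using S u by (intro mult_right_mono) auto
  moreover have "0 \<le> (u - (S + 1))\<^sup>2 / 2" by simp
  moreover have "0 \<le> (S + 1)\<^sup>2" by simp
  ultimately show ?thesis unfolding lim_exponent_def by (simp add: power2_eq_square algebra_simps)
qed

text \<open>
  The second and third order Taylor bounds for \<open>ln (1 + u / r)\<close> show that the exponents differ by
  at most \<open>1 / r\<close> times a polynomial in \<open>u\<close>, for all \<open>u\<close> and not only for \<open>u\<close> small against
  \<open>r\<close>.
\<close>

lemma exponent_diff_le:
  assumes S: "\<bar>\<sigma>\<bar> \<le> S" and r: "r > 0" and u: "u \<ge> 0"
  shows "r * \<bar>pre_exponent r \<sigma> u - lim_exponent \<sigma> u\<bar> \<le> u ^ 3 / 3 + S * u\<^sup>2 / 2 + u"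
proof -
  define x where "x = u / r"
  have x: "x \<ge> 0" using u r by (simp add: x_def)
  have ux: "u = r * x" using r by (simp add: x_def)
  define a where "a = ln (1 + x) - x + x\<^sup>2 / 2"
  define b where "b = x - ln (1 + x)"
  have a: "0 \<le> a" "a \<le> x ^ 3 / 3" using ln_one_plus_ge[OF x] ln_one_plus_le_cubic[OF x] by (auto simp: a_def)
  have b: "0 \<le> b" "b \<le> x\<^sup>2 / 2"
    using ln_add_one_self_le_self[OF x] ln_one_plus_ge[OF x] by (auto simp: b_def)
  have l: "0 \<le> x - b" using x by (simp add: b_def)
  have "r * (pre_exponent r \<sigma> u - lim_exponent \<sigma> u) = r ^ 3 * a - \<sigma> * r\<^sup>2 * b - r * (x - b)"
    unfolding pre_exponent_def lim_exponent_def ux a_def b_def using r by (simp add: field_simps power2_eq_square power3_eq_cube)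
  moreover have "r ^ 3 * a \<le> r ^ 3 * (x ^ 3 / 3)" using a r by (intro mult_left_mono) auto
  moreover have "0 \<le> r ^ 3 * a" using a r by simp
  moreover have "\<bar>\<sigma> * r\<^sup>2 * b\<bar> \<le> S * (r\<^sup>2 * (x\<^sup>2 / 2))"
    unfolding abs_mult mult.assoc using b S by (intro mult_mono) auto
  moreover have "0 \<le> r * (x - b)" using l r by simp
  moreover have "r * (x - b) \<le> r * x" using b r by (intro mult_left_mono) auto
  ultimately have "\<bar>r * (pre_exponent r \<sigma> u - lim_exponent \<sigma> u)\<bar> \<le> r ^ 3 * (x ^ 3 / 3) + S * (r\<^sup>2 * (x\<^sup>2 / 2)) + r * x"
    by linarith
  then show ?thesis using r by (simp add: ux abs_mult power_mult_distrib)
qed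

lemma abs_exp_diff_le:
  fixes a b M :: real
  assumes "a \<le> M" "b \<le> M"
  shows "\<bar>exp a - exp b\<bar> \<le> exp M * \<bar>a - b\<bar>"
proof -
  have *: "exp x - exp y \<le> exp M * \<bar>x - y\<bar>" if "x \<le> M" for x y :: real
  proof -
    have "exp x - exp y = exp x * (1 - exp (y - x))" by (simp add: exp_diff right_diff_distrib)
    also have "\<dots> \<le> exp x * \<bar>x - y\<bar>" 
    proof (rule mult_left_mono)
      show "1 - exp (y - x) \<le> \<bar>x - y\<bar>" using exp_ge_add_one_self[of "y - x"] by linarith
    qed simp
    also have "\<dots> \<le> exp M * \<bar>x - y\<bar>" using that by (intro mult_right_mono) auto
    finally show ?thesis .
  qed
  show ?thesis using *[OF assms(1), of b] *[OF assms(2), of a] by (auto simp: abs_minus_commute)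
qed

text \<open>
  With \<open>y = u / r\<close>, the scaled difference splits into the remainders of \<open>ln (1 + y)\<close> of order
  three, two and one, each divided by the matching power of \<open>y\<close>.
\<close>

lemma exponent_diff_tendsto:
  assumes r: "filterlim r at_top sequentially" and \<sigma>: "\<sigma> \<longlonglongrightarrow> \<tau>" and u: "u \<ge> 0"
  shows "(\<lambda>n. r n * (pre_exponent (r n) (\<sigma> n) u - lim_exponent (\<sigma> n) u)) \<longlonglongrightarrow> u ^ 3 / 3 - \<tau> * u\<^sup>2 / 2 - u"
proof (cases "u = 0")
  case True
  then show ?thesis by (simp add: pre_exponent_def lim_exponent_def)
next
  case False
  with u have u: "u > 0" by simp
  have y: "filterlim (\<lambda>n. u / r n) (at_right 0) sequentially"
    unfolding filterlim_at
  proof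
    show "(\<lambda>n. u / r n) \<longlonglongrightarrow> 0"
      by (rule real_tendsto_divide_at_top[OF tendsto_const r])
    show "\<forall>\<^sub>F n in sequentially. u / r n \<in> {0<..} \<and> u / r n \<noteq> 0"
      using filterlim_at_top_dense[THEN iffD1, OF r, rule_format, of 0] u by (auto elim: eventually_mono)
  qed
  have 1: "((\<lambda>y::real. (ln (1 + y) - y + y\<^sup>2 / 2) / y ^ 3) \<longlongrightarrow> 1 / 3) (at_right 0)"
    by real_asymp
  have 2: "((\<lambda>y::real. (ln (1 + y) - y) / y\<^sup>2) \<longlongrightarrow> - 1 / 2) (at_right 0)"
    by real_asymp
  have 3: "((\<lambda>y::real. ln (1 + y) / y) \<longlongrightarrow> 1) (at_right 0)"
    by real_asymp
  note L = filterlim_compose[OF 1 y] filterlim_compose[OF 2 y] filterlim_compose[OF 3 y]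
  let ?y = "\<lambda>n. u / r n"
  let ?l = "\<lambda>n. u ^ 3 * ((ln (1 + ?y n) - ?y n + (?y n)\<^sup>2 / 2) / (?y n) ^ 3)
      + \<sigma> n * (u\<^sup>2 * ((ln (1 + ?y n) - ?y n) / (?y n)\<^sup>2)) - u * (ln (1 + ?y n) / ?y n)"
  have "?l \<longlonglongrightarrow> u ^ 3 * (1 / 3) + \<tau> * (u\<^sup>2 * (- 1 / 2)) - u * 1"
    by (intro tendsto_intros L \<sigma>)
  moreover have "\<forall>\<^sub>F n in sequentially. ?l n = r n * (pre_exponent (r n) (\<sigma> n) u - lim_exponent (\<sigma> n) u)"
    using filterlim_at_top_dense[THEN iffD1, OF r, rule_format, of 0]
  proof eventually_elim
    case (elim n)
    define x where "x = u / r n"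
    have ux: "u = r n * x" and x: "x > 0" using elim u by (auto simp: x_def)
    show ?case
      unfolding pre_exponent_def lim_exponent_def x_def[symmetric] unfolding ux using elim x
      by (simp add: field_simps power2_eq_square power3_eq_cube)
  qed
  ultimately show ?thesis by (simp add: tendsto_cong)
qed

text \<open>
  Since \<open>exp\<close> has derivative \<open>1\<close> at \<open>0\<close>, \<open>exp a - exp b\<close> equals \<open>(a - b) * exp b\<close> up to a
  relative error that vanishes with \<open>a - b\<close>.
\<close>

lemma scaled_exp_diff_tendsto:
  fixes r a b :: "nat \<Rightarrow> real"
  assumes r: "filterlim r at_top sequentially"
    and d: "(\<lambda>n. r n * (a n - b n)) \<longlonglongrightarrow> l" and b: "b \<longlonglongrightarrow> \<beta>"
  shows "(\<lambda>n. r n * (exp (a n) - exp (b n))) \<longlonglongrightarrow> l * exp \<beta>"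
proof -
  obtain g :: "real \<Rightarrow> real" where g: "\<And>z. exp z - exp 0 = g z * (z - 0)" "isCont g 0" "g 0 = exp 0"
    using CARAT_DERIV[THEN iffD1, OF DERIV_exp[of "0::real"]] by blast
  have "(\<lambda>n. inverse (r n) * (r n * (a n - b n))) \<longlonglongrightarrow> 0 * l"
    by (intro tendsto_mult d tendsto_inverse_0_at_top r)
  moreover have "\<forall>\<^sub>F n in sequentially. inverse (r n) * (r n * (a n - b n)) = a n - b n"
    using filterlim_at_top_dense[THEN iffD1, OF r, rule_format, of 0]
    by eventually_elim auto
  ultimately have "(\<lambda>n. a n - b n) \<longlonglongrightarrow> 0" by (simp add: tendsto_cong)
  then have "(\<lambda>n. g (a n - b n)) \<longlonglongrightarrow> 1"
    using isCont_tendsto_compose[OF g(2)] g(3) by fastforce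
  then have "(\<lambda>n. (r n * (a n - b n)) * g (a n - b n) * exp (b n)) \<longlonglongrightarrow> l * 1 * exp \<beta>"
    by (intro tendsto_intros d b)
  moreover have "(r n * (a n - b n)) * g (a n - b n) * exp (b n) = r n * (exp (a n) - exp (b n))" for n
  proof -
    have "exp (a n) = exp (b n) * exp (a n - b n)" by (simp flip: exp_add)
    moreover have "exp (a n - b n) = 1 + g (a n - b n) * (a n - b n)"
      using g(1)[of "a n - b n"] by simp
    ultimately show ?thesis by (simp only:) (simp add: algebra_simps)
  qed
  ultimately show ?thesis by simp
qed

lemma pre_exponent_measurable [measurable]: "pre_exponent r \<sigma> \<in> borel_measurable borel"
  unfolding pre_exponent_def by measurable

lemma lim_exponent_measurable [measurable]: "lim_exponent \<sigma> \<in> borel_measurable borel"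
  unfolding lim_exponent_def by measurable

lemma set_integrable_dominated_exp:
  fixes f :: "real \<Rightarrow> real"
  assumes [measurable]: "f \<in> borel_measurable borel"
    and b: "\<And>u. u \<ge> 0 \<Longrightarrow> f u \<le> C - u"
  shows "set_integrable lborel {0..} (\<lambda>u. u ^ k * exp (f u))"
  unfolding set_integrable_def
proof (rule Bochner_Integration.integrable_bound)
  show "integrable lborel (\<lambda>u. exp C * (indicator {0..} u *\<^sub>R (u ^ k * exp (- u))))"
    using integrable.intros[OF has_bochner_integral_power_exp] by (intro integrable_mult_right)
  show "AE u in lborel. norm (indicator {0..} u *\<^sub>R (u ^ k * exp (f u)))
      \<le> norm (exp C * (indicator {0..} u *\<^sub>R (u ^ k * exp (- u))))"
  proof (rule AE_I2)
    fix u :: real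
    show "norm (indicator {0..} u *\<^sub>R (u ^ k * exp (f u)))
      \<le> norm (exp C * (indicator {0..} u *\<^sub>R (u ^ k * exp (- u))))"
    proof (cases "u \<ge> 0")
      case True
      have "exp (f u) \<le> exp C * exp (- u)" using b[OF True] by (simp flip: exp_add)
      then have "u ^ k * exp (f u) \<le> u ^ k * (exp C * exp (- u))" using True by (intro mult_left_mono) auto
      then show ?thesis using True by (simp add: abs_mult mult_ac)
    qed auto
  qed
qed measurable

lemma set_integrable_pre_exponent:
  assumes "r \<ge> 4 * (\<bar>\<sigma>\<bar> + 1)"
  shows "set_integrable lborel {0..} (\<lambda>u. u ^ k * exp (pre_exponent r \<sigma> u))"
  by (rule set_integrable_dominated_exp[OF _ pre_exponent_le[OF order_refl assms]]) auto

lemma set_integrable_lim_exponent: "set_integrable lborel {0..} (\<lambda>u. u ^ k * exp (lim_exponent \<sigma> u))"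
  by (rule set_integrable_dominated_exp[OF _ lim_exponent_le[OF order_refl]]) auto

text \<open>
  Dominated convergence, the integrand being bounded by a cubic polynomial times \<open>u * exp (- u)\<close>.
  The parameter \<open>\<sigma> n\<close> moves with \<open>n\<close>, which later replaces uniformity in \<open>\<sigma>\<close>.
\<close>

lemma pre_integral_expansion_bounded:
  fixes r \<sigma> :: "nat \<Rightarrow> real" and S :: real
  assumes r: "filterlim r at_top sequentially" and \<sigma>: "\<sigma> \<longlonglongrightarrow> \<tau>"
    and S: "\<And>n. \<bar>\<sigma> n\<bar> \<le> S" and r0: "\<And>n. r n \<ge> 4 * (S + 1)"
  shows "(\<lambda>n. r n * (pre_integral (r n) (\<sigma> n) - lim_integral (\<sigma> n))) \<longlonglongrightarrow> corr_integral \<tau>"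
proof -
  have S0: "S \<ge> 0" using S[of 0] by linarith
  have "0 < 4 * (S + 1)" using S0 by simp
  then have rp: "r n > 0" for n using r0[of n] by (rule less_le_trans)
  define C where "C = 4 * (S + 1)\<^sup>2"
  define f where "f = (\<lambda>n u. indicator {0..} u *\<^sub>R (u * (r n * (exp (pre_exponent (r n) (\<sigma> n) u) - exp (lim_exponent (\<sigma> n) u)))))"
  define W where "W = (\<lambda>u::real. exp C * ((indicator {0..} u *\<^sub>R (u ^ 4 * exp (- u))) / 3
     + S * (indicator {0..} u *\<^sub>R (u ^ 3 * exp (- u))) / 2 + indicator {0..} u *\<^sub>R (u ^ 2 * exp (- u))))"
  have "(\<lambda>n. integral\<^sup>L lborel (f n)) \<longlonglongrightarrow> integral\<^sup>L lborel
      (\<lambda>u. indicator {0..} u *\<^sub>R (u * (u ^ 3 / 3 - \<tau> * u\<^sup>2 / 2 - u) * exp (lim_exponent \<tau> u)))"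
  proof (rule integral_dominated_convergence[where w = W])
    have I: "integrable lborel (\<lambda>u::real. indicator {0..} u *\<^sub>R (u ^ k * exp (- u)))" for k
      using integrable.intros[OF has_bochner_integral_power_exp] .
    show "integrable lborel W" unfolding W_def
      by (intro integrable_mult_right Bochner_Integration.integrable_add integrable_divide I)
    show "AE u in lborel. (\<lambda>n. f n u) \<longlonglongrightarrow> indicator {0..} u *\<^sub>R (u * (u ^ 3 / 3 - \<tau> * u\<^sup>2 / 2 - u) * exp (lim_exponent \<tau> u))"
    proof (rule AE_I2)
      fix u :: real
      have "(\<lambda>n. r n * (exp (pre_exponent (r n) (\<sigma> n) u) - exp (lim_exponent (\<sigma> n) u))) \<longlonglongrightarrow> (u ^ 3 / 3 - \<tau> * u\<^sup>2 / 2 - u) * exp (lim_exponent \<tau> u)"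
        if "u \<ge> 0"
        by (rule scaled_exp_diff_tendsto[OF r exponent_diff_tendsto[OF r \<sigma> that]])
          (unfold lim_exponent_def, intro tendsto_intros \<sigma>)
      then show "(\<lambda>n. f n u) \<longlonglongrightarrow> indicator {0..} u *\<^sub>R (u * (u ^ 3 / 3 - \<tau> * u\<^sup>2 / 2 - u) * exp (lim_exponent \<tau> u))"
        unfolding f_def mult.assoc by (cases "u \<ge> 0") (auto intro!: tendsto_intros)
    qed
    show "AE u in lborel. norm (f n u) \<le> W u" for n
    proof (rule AE_I2)
      fix u :: real
      show "norm (f n u) \<le> W u"
      proof (cases "u \<ge> 0")
        case True
        have "r n * \<bar>exp (pre_exponent (r n) (\<sigma> n) u) - exp (lim_exponent (\<sigma> n) u)\<bar>
            \<le> r n * (exp (C - u) * \<bar>pre_exponent (r n) (\<sigma> n) u - lim_exponent (\<sigma> n) u\<bar>)"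
          unfolding C_def using rp[of n]
          by (intro mult_left_mono abs_exp_diff_le pre_exponent_le lim_exponent_le S r0 True) auto
        also have "\<dots> = exp (C - u) * (r n * \<bar>pre_exponent (r n) (\<sigma> n) u - lim_exponent (\<sigma> n) u\<bar>)" by simp
        also have "\<dots> \<le> exp (C - u) * (u ^ 3 / 3 + S * u\<^sup>2 / 2 + u)"
          by (intro mult_left_mono exponent_diff_le S rp True) auto
        finally have "u * (r n * \<bar>exp (pre_exponent (r n) (\<sigma> n) u) - exp (lim_exponent (\<sigma> n) u)\<bar>)
            \<le> u * (exp (C - u) * (u ^ 3 / 3 + S * u\<^sup>2 / 2 + u))" using True by (intro mult_left_mono)
        moreover have "norm (f n u) = u * (r n * \<bar>exp (pre_exponent (r n) (\<sigma> n) u) - exp (lim_exponent (\<sigma> n) u)\<bar>)"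
          using True rp[of n] by (simp add: f_def abs_mult)
        moreover have "W u = u * (exp (C - u) * (u ^ 3 / 3 + S * u\<^sup>2 / 2 + u))"
          using True by (simp add: W_def exp_diff exp_minus field_simps power2_eq_square power3_eq_cube power4_eq_xxxx)
        ultimately show ?thesis by simp
      qed (auto simp: f_def W_def)
    qed
  qed (unfold f_def, measurable)
  moreover have "integral\<^sup>L lborel (f n) = r n * (pre_integral (r n) (\<sigma> n) - lim_integral (\<sigma> n))" for n
  proof -
    have "4 * (\<bar>\<sigma> n\<bar> + 1) \<le> 4 * (S + 1)" using S[of n] by simp
    then have "r n \<ge> 4 * (\<bar>\<sigma> n\<bar> + 1)" using r0[of n] by (rule order_trans)
    note I = set_integrable_pre_exponent[OF this, of 1] set_integrable_lim_exponent[of 1 "\<sigma> n"]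
    have "integral\<^sup>L lborel (f n) = (LBINT u:{0..}. r n * (u * exp (pre_exponent (r n) (\<sigma> n) u) - u * exp (lim_exponent (\<sigma> n) u)))"
      unfolding f_def set_lebesgue_integral_def by (intro Bochner_Integration.integral_cong) (auto simp: algebra_simps)
    also have "\<dots> = r n * (pre_integral (r n) (\<sigma> n) - lim_integral (\<sigma> n))"
      using I by (simp add: pre_integral_def lim_integral_def set_integral_diff)
    finally show ?thesis .
  qed
  ultimately show ?thesis by (simp add: corr_integral_def set_lebesgue_integral_def)
qed

lemma pre_integral_expansion:
  fixes r \<sigma> :: "nat \<Rightarrow> real"
  assumes r: "filterlim r at_top sequentially" and \<sigma>: "\<sigma> \<longlonglongrightarrow> \<tau>"
  shows "(\<lambda>n. r n * (pre_integral (r n) (\<sigma> n) - lim_integral (\<sigma> n))) \<longlonglongrightarrow> corr_integral \<tau>"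
proof -
  obtain S :: real where S: "\<And>n. \<bar>\<sigma> n\<bar> \<le> S"
    using convergent_imp_Bseq[OF convergentI[OF \<sigma>]] by (auto simp: Bseq_def)
  obtain N where N: "\<And>n. n \<ge> N \<Longrightarrow> r n \<ge> 4 * (S + 1)"
    using filterlim_at_top[THEN iffD1, OF r, rule_format, of "4 * (S + 1)"] by (auto simp: eventually_sequentially)
  have "(\<lambda>n. r (n + N) * (pre_integral (r (n + N)) (\<sigma> (n + N)) - lim_integral (\<sigma> (n + N)))) \<longlonglongrightarrow> corr_integral \<tau>"
    by (rule pre_integral_expansion_bounded[where S = S])
      (auto intro: filterlim_compose[OF r filterlim_add_const_nat_at_top] LIMSEQ_ignore_initial_segment \<sigma> S N[simplified])
  then show ?thesis by (rule LIMSEQ_offset)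
qed

section \<open>The limit function q\<close>

text \<open>
  This is the Mills ratio of the standard normal distribution at \<open>- \<sigma>\<close>.
\<close>

definition cdf_ratio :: "real \<Rightarrow> real" where
  "cdf_ratio \<sigma> = cdf std_normal_distribution \<sigma> / std_normal_density \<sigma>"

lemma cdf_std_normal_eq_set_integral:
  "cdf std_normal_distribution \<sigma> = (LBINT x:{..\<sigma>}. std_normal_density x)"
proof -
  have "emeasure std_normal_distribution {..\<sigma>} = (\<integral>\<^sup>+ x. ennreal (indicator {..\<sigma>} x *\<^sub>R std_normal_density x) \<partial>lborel)"
    by (subst emeasure_density) (auto intro!: nn_integral_cong split: split_indicator)
  also have "\<dots> = ennreal (LBINT x:{..\<sigma>}. std_normal_density x)"
    unfolding set_lebesgue_integral_def
    by (intro nn_integral_eq_integral integrable_mult_indicator) (auto intro: integrable_normal_density)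
  finally show ?thesis
    unfolding cdf_def measure_def by (simp add: set_lebesgue_integral_def integral_nonneg_AE)
qed

lemma cdf_ratio_eq: "cdf_ratio \<sigma> = (LBINT u:{0..}. exp (lim_exponent \<sigma> u))"
proof -
  have *: "std_normal_density (\<sigma> - u) = std_normal_density \<sigma> * exp (lim_exponent \<sigma> u)" for u
    unfolding std_normal_density_def lim_exponent_def
    by (simp add: power2_eq_square field_simps flip: exp_add)
  have "cdf std_normal_distribution \<sigma> = (\<integral>u. indicator {..\<sigma>} (\<sigma> + (-1) * u) *\<^sub>R std_normal_density (\<sigma> + (-1) * u) \<partial>lborel)"
    unfolding cdf_std_normal_eq_set_integral set_lebesgue_integral_def
    by (subst lborel_integral_real_affine[of "-1" _ \<sigma>]) auto
  also have "\<dots> = (\<integral>u. std_normal_density \<sigma> * (indicator {0..} u *\<^sub>R exp (lim_exponent \<sigma> u)) \<partial>lborel)"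
    by (intro Bochner_Integration.integral_cong) (auto simp: * split: split_indicator)
  also have "\<dots> = std_normal_density \<sigma> * (LBINT u:{0..}. exp (lim_exponent \<sigma> u))"
    by (simp add: set_lebesgue_integral_def)
  finally show ?thesis using normal_density_pos[of 1 0 \<sigma>] by (simp add: cdf_ratio_def)
qed

text \<open>
  The integrand is the derivative of \<open>- exp (lim_exponent \<sigma> u)\<close>.
\<close>

lemma lim_exponent_FTC: "(LBINT u:{0..}. (u - \<sigma>) * exp (lim_exponent \<sigma> u)) = 1"
proof -
  let ?f = "\<lambda>u. (u - \<sigma>) * exp (lim_exponent \<sigma> u)"
  have int: "set_integrable lborel {0..} ?f"
    using set_integral_diff(1)[OF set_integrable_lim_exponent[of 1 \<sigma>] set_integrable_mult_right[OF set_integrable_lim_exponent[of 0 \<sigma>], of \<sigma>]]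
    by (simp add: left_diff_distrib)
  have lim: "((\<lambda>u. - exp (lim_exponent \<sigma> u)) \<longlongrightarrow> 0) at_top"
    unfolding lim_exponent_def by real_asymp
  have "(LBINT u=ereal 0..\<infinity>. ?f u) = 0 - (- 1)"
  proof (rule interval_integral_FTC_integrable[where F = "\<lambda>u. - exp (lim_exponent \<sigma> u)"])
    show "((\<lambda>u. - exp (lim_exponent \<sigma> u)) has_vector_derivative ?f x) (at x)" for x
      unfolding lim_exponent_def has_real_derivative_iff_has_vector_derivative[symmetric]
      by (auto intro!: derivative_eq_intros simp: algebra_simps)
    show "isCont ?f x" for x unfolding lim_exponent_def by (intro continuous_intros) auto
    show "set_integrable lborel (einterval (ereal 0) \<infinity>) ?f"
      by (rule set_integrable_subset[OF int]) (auto simp: einterval_def)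
    show "(((\<lambda>u. - exp (lim_exponent \<sigma> u)) \<circ> real_of_ereal) \<longlongrightarrow> - 1) (at_right (ereal 0))"
    proof -
      have "((\<lambda>u. - exp (lim_exponent \<sigma> u)) \<longlongrightarrow> - exp (lim_exponent \<sigma> 0)) (at_right 0)"
        unfolding lim_exponent_def by (intro tendsto_intros) auto
      then show ?thesis by (simp add: ereal_tendsto_simps lim_exponent_def)
    qed
    show "(((\<lambda>u. - exp (lim_exponent \<sigma> u)) \<circ> real_of_ereal) \<longlongrightarrow> 0) (at_left \<infinity>)"
      using lim by (simp add: ereal_tendsto_simps)
  qed simp
  also have "(LBINT u=ereal 0..\<infinity>. ?f u) = (LBINT u:{0..}. ?f u)"
    unfolding interval_integral_to_infinity_eq
    by (rule set_integral_cong_set) 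
       (use AE_lborel_singleton[of 0] in \<open>auto simp: set_borel_measurable_def elim!: eventually_mono\<close>)
  finally show ?thesis by simp
qed

text \<open>
  Splitting \<open>u = (u - \<sigma>) + \<sigma>\<close> identifies the limit integral with the factor in the definition of
  \<open>q\<close>.
\<close>

lemma lim_integral_eq: "lim_integral \<sigma> = 1 + \<sigma> * cdf_ratio \<sigma>"
proof -
  have "(LBINT u:{0..}. (u - \<sigma>) * exp (lim_exponent \<sigma> u)) = lim_integral \<sigma> - \<sigma> * cdf_ratio \<sigma>"
    using set_integral_diff(2)[OF set_integrable_lim_exponent[of 1 \<sigma>] set_integrable_mult_right[OF set_integrable_lim_exponent[of 0 \<sigma>], of \<sigma>]]
    by (simp add: left_diff_distrib lim_integral_def cdf_ratio_eq)
  then show ?thesis by (simp add: lim_exponent_FTC)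
qed

lemma q_eq: "q \<sigma> = 1 / (\<sigma> * lim_integral \<sigma>)"
  by (simp add: q_def lim_integral_eq cdf_ratio_def)

lemma cdf_ratio_nonneg: "cdf_ratio \<sigma> \<ge> 0"
  by (simp add: cdf_ratio_def cdf_def)

lemma lim_integral_ge_1: "\<sigma> \<ge> 0 \<Longrightarrow> lim_integral \<sigma> \<ge> 1"
  by (simp add: lim_integral_eq cdf_ratio_nonneg)

lemma cdf_std_normal_deriv:
  "(cdf std_normal_distribution has_real_derivative std_normal_density x) (at x)"
proof -
  interpret real_distribution std_normal_distribution by (rule real_dist_normal_dist)
  \<comment> \<open>An auxiliary base point below \<open>x\<close>: the distribution function is a constant plus an integral over a compact interval near \<open>x\<close>.\<close>
  define a where "a = x - 1"
  have cont: "continuous_on S std_normal_density" for S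
    unfolding std_normal_density_def by (intro continuous_intros) auto
  have "((\<lambda>y. integral {a..y} std_normal_density) has_real_derivative std_normal_density x) (at x within {a..x+1})"
    by (rule integral_has_real_derivative[OF cont]) (simp add: a_def)
  then have "((\<lambda>y. integral {a..y} std_normal_density) has_real_derivative std_normal_density x) (at x)"
    by (subst (asm) at_within_interior) (auto simp: a_def)
  then have d: "((\<lambda>y. cdf std_normal_distribution a + integral {a..y} std_normal_density) has_real_derivative std_normal_density x) (at x)"
    by (auto intro!: derivative_eq_intros)
  have eq: "cdf std_normal_distribution a + integral {a..y} std_normal_density = cdf std_normal_distribution y" if "y > a" for y
  proof -
    have I: "set_integrable lborel A std_normal_density" if "A \<in> sets borel" for A
      using that integrable_mult_indicator[OF _ integrable_normal_density, of A] by (simp add: set_integrable_def)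
    have "{..y} = {..a} \<union> {a<..y}" using that by auto
    then have "cdf std_normal_distribution y = cdf std_normal_distribution a + (LBINT x:{a<..y}. std_normal_density x)"
      unfolding cdf_std_normal_eq_set_integral by (simp only:) (intro set_integral_Un I, auto)
    also have "(LBINT x:{a<..y}. std_normal_density x) = (LBINT x:{a..y}. std_normal_density x)"
      by (rule set_integral_cong_set) 
         (use AE_lborel_singleton[of a] in \<open>auto simp: set_borel_measurable_def elim!: eventually_mono\<close>)
    also have "\<dots> = integral {a..y} std_normal_density"
      by (intro set_borel_integral_eq_integral I) auto
    finally show ?thesis by simp
  qed
  show ?thesis
    by (rule has_field_derivative_transform_within_open[OF d, of "{a<..}"]) (simp_all add: eq, simp add: a_def)
qed

lemma cdf_ratio_deriv [derivative_intros]: "(cdf_ratio has_real_derivative lim_integral \<sigma>) (at \<sigma>)"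
proof -
  have pos: "std_normal_density \<sigma> > 0" by (rule normal_density_pos) simp
  have 1: "(std_normal_density has_real_derivative (- \<sigma> * std_normal_density \<sigma>)) (at \<sigma>)"
  proof -
    have "((\<lambda>x. exp (- x\<^sup>2 / 2)) has_real_derivative (- \<sigma> * exp (- \<sigma>\<^sup>2 / 2))) (at \<sigma>)"
      by (auto intro!: derivative_eq_intros)
    from DERIV_cmult[OF this, of "1 / sqrt (2 * pi)"] show ?thesis
      by (simp add: std_normal_density_def[abs_def])
  qed
  have "(cdf_ratio has_real_derivative
      (std_normal_density \<sigma> * std_normal_density \<sigma> - cdf std_normal_distribution \<sigma> * (- \<sigma> * std_normal_density \<sigma>))
      / (std_normal_density \<sigma> * std_normal_density \<sigma>)) (at \<sigma>)"
    unfolding cdf_ratio_def[abs_def] by (rule DERIV_divide[OF cdf_std_normal_deriv 1]) (use pos in simp)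
  also have "(std_normal_density \<sigma> * std_normal_density \<sigma> - cdf std_normal_distribution \<sigma> * (- \<sigma> * std_normal_density \<sigma>))
      / (std_normal_density \<sigma> * std_normal_density \<sigma>) = lim_integral \<sigma>"
    using pos by (simp add: lim_integral_eq cdf_ratio_def field_simps)
  finally show ?thesis .
qed

lemma lim_integral_deriv: "(lim_integral has_real_derivative (cdf_ratio \<sigma> + \<sigma> * lim_integral \<sigma>)) (at \<sigma>)"
  unfolding lim_integral_eq[abs_def] by (auto intro!: derivative_eq_intros simp: lim_integral_eq)

lemma lim_integral_cont: "isCont lim_integral \<sigma>"
  by (rule DERIV_isCont[OF lim_integral_deriv])

text \<open>
  With \<open>f \<sigma> = \<sigma> * lim_integral \<sigma>\<close> and \<open>q = 1 / f\<close>, the derivatives of \<open>q\<close> are \<open>- f' / f\<^sup>2\<close> and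
  \<open>(2 * f'\<^sup>2 - f * f'') / f ^ 3\<close>. Both numerators are expressed through \<open>\<sigma>\<close> and \<open>lim_integral \<sigma>\<close>
  alone by means of \<open>lim_integral_eq\<close>.
\<close>

definition dq :: "real \<Rightarrow> real" where
  "dq \<sigma> = - ((2 + \<sigma>\<^sup>2) * lim_integral \<sigma> - 1) / (\<sigma> * lim_integral \<sigma>)\<^sup>2"

definition ddq :: "real \<Rightarrow> real" where
  "ddq \<sigma> = ((6 + 3 * \<sigma>\<^sup>2 + \<sigma> ^ 4) * (lim_integral \<sigma>)\<^sup>2 - (6 + 3 * \<sigma>\<^sup>2) * lim_integral \<sigma> + 2) / (\<sigma> * lim_integral \<sigma>) ^ 3"

lemma q_deriv:
  assumes "\<sigma> > 0"
  shows "(q has_real_derivative dq \<sigma>) (at \<sigma>)"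
proof -
  have nz: "\<sigma> * lim_integral \<sigma> \<noteq> 0" using assms lim_integral_ge_1[of \<sigma>] by auto
  have "((\<lambda>\<sigma>. \<sigma> * lim_integral \<sigma>) has_real_derivative lim_integral \<sigma> + \<sigma> * (cdf_ratio \<sigma> + \<sigma> * lim_integral \<sigma>)) (at \<sigma>)"
    by (auto intro!: derivative_eq_intros lim_integral_deriv)
  also have "lim_integral \<sigma> + \<sigma> * (cdf_ratio \<sigma> + \<sigma> * lim_integral \<sigma>) = (2 + \<sigma>\<^sup>2) * lim_integral \<sigma> - 1"
    by (simp add: lim_integral_eq algebra_simps power2_eq_square)
  finally have d: "((\<lambda>\<sigma>. \<sigma> * lim_integral \<sigma>) has_real_derivative (2 + \<sigma>\<^sup>2) * lim_integral \<sigma> - 1) (at \<sigma>)" .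
  have "((\<lambda>\<sigma>. 1 / (\<sigma> * lim_integral \<sigma>)) has_real_derivative dq \<sigma>) (at \<sigma>)"
    using DERIV_divide[OF DERIV_const[of 1] d nz] by (simp add: dq_def power2_eq_square)
  then show ?thesis by (simp add: q_eq[abs_def])
qed

lemma dq_deriv:
  assumes "\<sigma> > 0"
  shows "(dq has_real_derivative ddq \<sigma>) (at \<sigma>)"
proof -
  define f where "f = (\<lambda>\<sigma>. \<sigma> * lim_integral \<sigma>)"
  define f1 where "f1 = (\<lambda>\<sigma>. (2 + \<sigma>\<^sup>2) * lim_integral \<sigma> - 1)"
  have nz: "f \<sigma> \<noteq> 0" using assms lim_integral_ge_1[of \<sigma>] by (auto simp: f_def)
  have "(f has_real_derivative lim_integral \<sigma> + \<sigma> * (cdf_ratio \<sigma> + \<sigma> * lim_integral \<sigma>)) (at \<sigma>)"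
    unfolding f_def by (auto intro!: derivative_eq_intros lim_integral_deriv)
  also have "lim_integral \<sigma> + \<sigma> * (cdf_ratio \<sigma> + \<sigma> * lim_integral \<sigma>) = f1 \<sigma>"
    by (simp add: f1_def lim_integral_eq algebra_simps power2_eq_square)
  finally have f: "(f has_real_derivative f1 \<sigma>) (at \<sigma>)" .
  define f2 where "f2 = 2 * \<sigma> * lim_integral \<sigma> + (2 + \<sigma>\<^sup>2) * (cdf_ratio \<sigma> + \<sigma> * lim_integral \<sigma>)"
  have f1: "(f1 has_real_derivative f2) (at \<sigma>)"
    unfolding f1_def f2_def by (auto intro!: derivative_eq_intros lim_integral_deriv)
  have "((\<lambda>\<sigma>. - f1 \<sigma> / (f \<sigma>)\<^sup>2) has_real_derivative (2 * (f1 \<sigma>)\<^sup>2 - f \<sigma> * f2) / f \<sigma> ^ 3) (at \<sigma>)"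
  proof -
    have "((\<lambda>\<sigma>. (f \<sigma>)\<^sup>2) has_real_derivative 2 * f \<sigma> * f1 \<sigma>) (at \<sigma>)"
      by (auto intro!: derivative_eq_intros f)
    moreover have "(f \<sigma>)\<^sup>2 \<noteq> 0" using nz by simp
    ultimately have "((\<lambda>\<sigma>. - f1 \<sigma> / (f \<sigma>)\<^sup>2) has_real_derivative
        (- f2 * (f \<sigma>)\<^sup>2 - - f1 \<sigma> * (2 * f \<sigma> * f1 \<sigma>)) / ((f \<sigma>)\<^sup>2 * (f \<sigma>)\<^sup>2)) (at \<sigma>)"
      by (intro DERIV_divide DERIV_minus f1)
    also have "- f2 * (f \<sigma>)\<^sup>2 - - f1 \<sigma> * (2 * f \<sigma> * f1 \<sigma>) = f \<sigma> * (2 * (f1 \<sigma>)\<^sup>2 - f \<sigma> * f2)"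
      by (simp add: algebra_simps power2_eq_square)
    also have "(f \<sigma>)\<^sup>2 * (f \<sigma>)\<^sup>2 = f \<sigma> * f \<sigma> ^ 3" by (simp add: power2_eq_square power3_eq_cube)
    finally show ?thesis using nz by simp
  qed
  also have "2 * (f1 \<sigma>)\<^sup>2 - f \<sigma> * f2 = (6 + 3 * \<sigma>\<^sup>2 + \<sigma> ^ 4) * (lim_integral \<sigma>)\<^sup>2 - (6 + 3 * \<sigma>\<^sup>2) * lim_integral \<sigma> + 2"
  proof -
    have "\<sigma> * f2 = 2 * \<sigma>\<^sup>2 * lim_integral \<sigma> + (2 + \<sigma>\<^sup>2) * (lim_integral \<sigma> - 1 + \<sigma>\<^sup>2 * lim_integral \<sigma>)"
      by (simp add: f2_def lim_integral_eq algebra_simps power2_eq_square)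
    then have "f \<sigma> * f2 = lim_integral \<sigma> * (2 * \<sigma>\<^sup>2 * lim_integral \<sigma> + (2 + \<sigma>\<^sup>2) * (lim_integral \<sigma> - 1 + \<sigma>\<^sup>2 * lim_integral \<sigma>))"
      by (simp add: f_def mult_ac)
    then show ?thesis by (simp add: f1_def algebra_simps power2_eq_square power4_eq_xxxx)
  qed
  finally show ?thesis unfolding dq_def[abs_def] ddq_def f_def f1_def .
qed

text \<open>
  Strict convexity of \<open>q\<close>: with \<open>J = lim_integral \<sigma>\<close>, the term \<open>(6 + 3 * \<sigma>\<^sup>2) * J\<^sup>2\<close> dominates
  \<open>(6 + 3 * \<sigma>\<^sup>2) * J\<close> because \<open>J\<close> is at least \<open>1\<close>.
\<close>

lemma ddq_pos:
  assumes "\<sigma> > 0"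
  shows "ddq \<sigma> > 0"
proof -
  have Jge: "lim_integral \<sigma> \<ge> 1" using lim_integral_ge_1 assms by simp
  have "(6 + 3 * \<sigma>\<^sup>2) * (lim_integral \<sigma> * 1) \<le> (6 + 3 * \<sigma>\<^sup>2) * (lim_integral \<sigma> * lim_integral \<sigma>)"
    using Jge by (intro mult_left_mono) auto
  moreover have "0 \<le> \<sigma> ^ 4 * (lim_integral \<sigma>)\<^sup>2" by simp
  ultimately have "(6 + 3 * \<sigma>\<^sup>2 + \<sigma> ^ 4) * (lim_integral \<sigma>)\<^sup>2 - (6 + 3 * \<sigma>\<^sup>2) * lim_integral \<sigma> + 2 > 0"
    by (simp add: algebra_simps power2_eq_square)
  then show ?thesis unfolding ddq_def using assms Jge by (intro divide_pos_pos) auto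
qed

lemma q_nonneg: "\<sigma> > 0 \<Longrightarrow> q \<sigma> \<ge> 0"
  using lim_integral_ge_1[of \<sigma>] by (simp add: q_eq)

section \<open>The limiting optimization problem\<close>

definition limit_cost :: "real \<Rightarrow> real \<Rightarrow> real \<Rightarrow> real" where
  "limit_cost h c \<sigma> = h * q \<sigma> + c * \<sigma>"

lemma limit_cost_deriv:
  "\<sigma> > 0 \<Longrightarrow> (limit_cost h c has_real_derivative h * dq \<sigma> + c) (at \<sigma>)"
  unfolding limit_cost_def[abs_def] by (auto intro!: derivative_eq_intros q_deriv)

lemma limit_cost_deriv2:
  "\<sigma> > 0 \<Longrightarrow> ((\<lambda>\<sigma>. h * dq \<sigma> + c) has_real_derivative h * ddq \<sigma>) (at \<sigma>)"
  by (auto intro!: derivative_eq_intros dq_deriv)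

lemma is_sigma_star_iff:
  "is_sigma_star h c \<sigma> \<longleftrightarrow> \<sigma> > 0 \<and> (\<forall>\<tau>>0. limit_cost h c \<sigma> \<le> limit_cost h c \<tau>)"
  unfolding is_sigma_star_def is_arg_min_def limit_cost_def by (meson linorder_not_le)

lemma is_sigma_star_deriv_0:
  assumes "is_sigma_star h c \<sigma>"
  shows "h * dq \<sigma> + c = 0"
proof -
  have \<sigma>: "\<sigma> > 0" and min: "\<And>\<tau>. \<tau> > 0 \<Longrightarrow> limit_cost h c \<sigma> \<le> limit_cost h c \<tau>"
    using assms by (auto simp: is_sigma_star_iff)
  show ?thesis
  proof (rule DERIV_local_min[OF limit_cost_deriv[OF \<sigma>] \<sigma>])
    show "\<forall>y. \<bar>\<sigma> - y\<bar> < \<sigma> \<longrightarrow> limit_cost h c \<sigma> \<le> limit_cost h c y"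
      by (auto intro!: min)
  qed
qed

text \<open>
  The limiting cost is at least its value at \<open>1\<close> near \<open>0\<close>, where \<open>q\<close> blows up, and for large \<open>\<sigma>\<close>, where
  the staffing term takes over; between, it attains its minimum by compactness.
\<close>

lemma ex_is_sigma_star:
  assumes h: "h > 0" and c: "c > 0"
  shows "\<exists>\<sigma>. is_sigma_star h c \<sigma>"
proof -
  let ?F = "limit_cost h c"
  define v where "v = ?F 1"
  have v: "v > 0" using h c q_nonneg[of 1] by (simp add: v_def limit_cost_def add_nonneg_pos)
  define K where "K = lim_integral 1"
  have K: "K \<ge> 1" by (simp add: K_def lim_integral_ge_1)
  \<comment> \<open>On \<open>{0<..a}\<close> the bound \<open>\<sigma> * lim_integral \<sigma> \<le> h / v\<close> gives \<open>h * q \<sigma> \<ge> v\<close>; from \<open>b\<close> on, \<open>c * \<sigma> \<ge> v\<close>.\<close>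
  define a where "a = min 1 (h / (K * v))"
  define b where "b = max 1 (v / c)"
  have a: "0 < a" "a \<le> 1" using h v K by (auto simp: a_def)
  have b: "1 \<le> b" by (simp add: b_def)
  have lim_integral_le_K: "lim_integral \<sigma> \<le> K" if "0 < \<sigma>" "\<sigma> \<le> 1" for \<sigma>
    unfolding K_def
  proof (rule DERIV_nonneg_imp_nondecreasing[OF that(2)])
    fix x assume "\<sigma> \<le> x" "x \<le> 1"
    then have "cdf_ratio x + x * lim_integral x \<ge> 0" using that(1) lim_integral_ge_1[of x] cdf_ratio_nonneg[of x] by auto
    then show "\<exists>y. (lim_integral has_real_derivative y) (at x) \<and> 0 \<le> y" using lim_integral_deriv by blast
  qed
  have out_low: "?F \<sigma> \<ge> v" if "0 < \<sigma>" "\<sigma> \<le> a" for \<sigma>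
  proof -
    have Jge: "lim_integral \<sigma> \<ge> 1" using lim_integral_ge_1[of \<sigma>] that by simp
    have "\<sigma> * lim_integral \<sigma> \<le> h / (K * v) * K"
      using that lim_integral_le_K[of \<sigma>] a Jge K h v by (intro mult_mono) (auto simp: a_def)
    also have "\<dots> = h / v" using K by simp
    finally have "v * (\<sigma> * lim_integral \<sigma>) \<le> h" using v by (simp add: field_simps)
    then have "v \<le> h * q \<sigma>" using that Jge by (simp add: q_eq field_simps)
    also have "\<dots> \<le> ?F \<sigma>" using c that by (simp add: limit_cost_def)
    finally show ?thesis .
  qed
  have out_high: "?F \<sigma> \<ge> v" if "\<sigma> \<ge> b" for \<sigma>
  proof -
    have "v \<le> c * \<sigma>" using that c by (simp add: b_def field_simps)
    also have "\<dots> \<le> ?F \<sigma>" using h that b q_nonneg[of \<sigma>] by (simp add: limit_cost_def)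
    finally show ?thesis .
  qed
  have "\<exists>x\<in>{a..b}. \<forall>y\<in>{a..b}. ?F x \<le> ?F y"
  proof (rule continuous_attains_inf)
    show "continuous_on {a..b} ?F"
      by (intro continuous_at_imp_continuous_on ballI DERIV_isCont[OF limit_cost_deriv]) (use a in auto)
  qed (use a b in auto)
  then obtain x where x: "x \<in> {a..b}" "\<And>y. y \<in> {a..b} \<Longrightarrow> ?F x \<le> ?F y" by blast
  have "?F x \<le> v" unfolding v_def using a b by (intro x) auto
  moreover have "?F x \<le> ?F y" if "y > 0" for y
    using x(2)[of y] out_low[of y] out_high[of y] that \<open>?F x \<le> v\<close> by (cases "y \<le> a"; cases "y \<ge> b") auto
  ultimately show ?thesis using x(1) a by (auto simp: is_sigma_star_iff intro!: exI[of _ x])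
qed

text \<open>
  The derivative of the limiting cost vanishes at every minimizer and is strictly increasing.
\<close>

lemma ex1_is_sigma_star:
  assumes h: "h > 0" and c: "c > 0"
  shows "\<exists>!\<sigma>. is_sigma_star h c \<sigma>"
proof -
  have "\<not> x < y" if "is_sigma_star h c x" "is_sigma_star h c y" for x y
  proof
    assume "x < y"
    have x: "x > 0" using that by (simp add: is_sigma_star_iff)
    have "h * dq x + c < h * dq y + c"
    proof (rule DERIV_pos_imp_increasing[OF \<open>x < y\<close>])
      fix z assume "x \<le> z" "z \<le> y"
      then show "\<exists>D. ((\<lambda>\<sigma>. h * dq \<sigma> + c) has_real_derivative D) (at z) \<and> 0 < D"
        using x h limit_cost_deriv2[of z h c] ddq_pos[of z] by (intro exI[of _ "h * ddq z"]) auto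
    qed
    then show False using is_sigma_star_deriv_0 that by simp
  qed
  then show ?thesis using ex_is_sigma_star[OF h c] by (metis linorder_neqE)
qed

lemma is_sigma_star_sigma_star:
  assumes "h > 0" "c > 0"
  shows "is_sigma_star h c (sigma_star h c)"
  unfolding sigma_star_def by (rule theI'[OF ex1_is_sigma_star[OF assms]])

text \<open>
  By the mean value theorem, the increase of the limiting cost over its minimum is \<open>\<sigma> - \<tau>\<close> times
  a value of its derivative, and the derivative vanishes at \<open>\<tau>\<close> and is differentiable there.
\<close>

lemma limit_cost_quadratic:
  fixes r \<sigma> :: "nat \<Rightarrow> real"
  assumes st: "is_sigma_star h c \<tau>"
    and r: "\<forall>\<^sub>F n in sequentially. r n > 0"
    and \<sigma>: "\<sigma> \<longlonglongrightarrow> \<tau>" and small: "(\<lambda>n. r n * (\<sigma> n - \<tau>)\<^sup>2) \<longlonglongrightarrow> 0"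
  shows "(\<lambda>n. r n * (limit_cost h c (\<sigma> n) - limit_cost h c \<tau>)) \<longlonglongrightarrow> 0"
proof -
  let ?F = "limit_cost h c"
  let ?F1 = "\<lambda>\<sigma>. h * dq \<sigma> + c"
  have \<tau>: "\<tau> > 0" and min: "\<And>x. x > 0 \<Longrightarrow> ?F \<tau> \<le> ?F x" using st by (auto simp: is_sigma_star_iff)
  \<comment> \<open>Caratheodory form of differentiability: \<open>?F1 z = g z * (z - \<tau>)\<close> with \<open>g\<close> bounded near \<open>\<tau>\<close>.\<close>
  obtain g where g: "\<And>z. ?F1 z - ?F1 \<tau> = g z * (z - \<tau>)" "isCont g \<tau>"
    using CARAT_DERIV[THEN iffD1, OF limit_cost_deriv2[OF \<tau>, of h c]] by blast
  have g: "?F1 z = g z * (z - \<tau>)" "isCont g \<tau>" for z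
    using g is_sigma_star_deriv_0[OF st] by auto
  obtain d where d: "d > 0" "\<And>z. \<bar>z - \<tau>\<bar> < d \<Longrightarrow> \<bar>g z - g \<tau>\<bar> < 1"
    using g(2) unfolding continuous_at_eps_delta dist_real_def by (meson zero_less_one)
  define K where "K = \<bar>g \<tau>\<bar> + 1"
  define e where "e = min d \<tau>"
  have e: "e > 0" using d \<tau> by (simp add: e_def)
  have bound: "?F x - ?F \<tau> \<le> K * (x - \<tau>)\<^sup>2" if x: "\<bar>x - \<tau>\<bar> < e" for x
  proof -
    have "\<exists>z. \<bar>z - \<tau>\<bar> \<le> \<bar>x - \<tau>\<bar> \<and> ?F x - ?F \<tau> = (x - \<tau>) * ?F1 z"
    proof (cases x \<tau> rule: linorder_cases)
      case less
      have "\<exists>z>x. z < \<tau> \<and> ?F \<tau> - ?F x = (\<tau> - x) * ?F1 z"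
        by (rule MVT2[OF less limit_cost_deriv]) (use x in \<open>auto simp: e_def\<close>)
      then obtain z where "z > x" "z < \<tau>" "?F \<tau> - ?F x = (\<tau> - x) * ?F1 z" by blast
      then show ?thesis by (intro exI[of _ z]) (auto simp: algebra_simps)
    next
      case greater
      have "\<exists>z>\<tau>. z < x \<and> ?F x - ?F \<tau> = (x - \<tau>) * ?F1 z"
        by (rule MVT2[OF greater limit_cost_deriv]) (use \<tau> in auto)
      then obtain z where "z > \<tau>" "z < x" "?F x - ?F \<tau> = (x - \<tau>) * ?F1 z" by blast
      then show ?thesis by (intro exI[of _ z]) auto
    qed auto
    then obtain z where z: "\<bar>z - \<tau>\<bar> \<le> \<bar>x - \<tau>\<bar>" "?F x - ?F \<tau> = (x - \<tau>) * ?F1 z" by blast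
    have "\<bar>g z - g \<tau>\<bar> < 1" using z x by (intro d) (auto simp: e_def)
    then have gz: "\<bar>g z\<bar> \<le> K" by (simp add: K_def)
    have "?F x - ?F \<tau> \<le> \<bar>(x - \<tau>) * (g z * (z - \<tau>))\<bar>" using z(2) g(1)[of z] by simp
    also have "\<dots> = \<bar>g z\<bar> * (\<bar>x - \<tau>\<bar> * \<bar>z - \<tau>\<bar>)" by (simp add: abs_mult)
    also have "\<dots> \<le> K * (\<bar>x - \<tau>\<bar> * \<bar>x - \<tau>\<bar>)"
      using gz z by (intro mult_mono) (auto simp: K_def)
    finally show ?thesis by (simp add: power2_eq_square)
  qed
  have close: "\<forall>\<^sub>F n in sequentially. \<bar>\<sigma> n - \<tau>\<bar> < e"
    using tendstoD[OF \<sigma> e] by (simp add: dist_real_def)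
  show ?thesis
  proof (rule tendsto_sandwich)
    show "\<forall>\<^sub>F n in sequentially. 0 \<le> r n * (?F (\<sigma> n) - ?F \<tau>)"
      using r close by eventually_elim (auto intro!: mult_nonneg_nonneg min simp: e_def)
    show "\<forall>\<^sub>F n in sequentially. r n * (?F (\<sigma> n) - ?F \<tau>) \<le> K * (r n * (\<sigma> n - \<tau>)\<^sup>2)"
      using r close
    proof eventually_elim
      case (elim n)
      have "r n * (?F (\<sigma> n) - ?F \<tau>) \<le> r n * (K * (\<sigma> n - \<tau>)\<^sup>2)"
        using elim bound by (intro mult_left_mono) auto
      then show ?case by (simp add: mult_ac)
    qed
    show "(\<lambda>n. K * (r n * (\<sigma> n - \<tau>)\<^sup>2)) \<longlonglongrightarrow> 0"
      using tendsto_mult_right_zero[OF small] by simp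
  qed simp
qed

lemma pre_integral_tendsto:
  fixes r \<sigma> :: "nat \<Rightarrow> real"
  assumes r: "filterlim r at_top sequentially" and \<sigma>: "\<sigma> \<longlonglongrightarrow> \<tau>"
  shows "(\<lambda>n. pre_integral (r n) (\<sigma> n)) \<longlonglongrightarrow> lim_integral \<tau>"
proof -
  have "(\<lambda>n. inverse (r n) * (r n * (pre_integral (r n) (\<sigma> n) - lim_integral (\<sigma> n))) + lim_integral (\<sigma> n)) \<longlonglongrightarrow> 0 * corr_integral \<tau> + lim_integral \<tau>"
    by (intro tendsto_intros pre_integral_expansion r \<sigma> tendsto_inverse_0_at_top isCont_tendsto_compose[OF lim_integral_cont])
  moreover have "\<forall>\<^sub>F n in sequentially.
      inverse (r n) * (r n * (pre_integral (r n) (\<sigma> n) - lim_integral (\<sigma> n))) + lim_integral (\<sigma> n) = pre_integral (r n) (\<sigma> n)"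
    using filterlim_at_top_dense[THEN iffD1, OF r, rule_format, of 0] by (rule eventually_mono) (simp add: field_simps)
  ultimately show ?thesis by (simp add: tendsto_cong)
qed

text \<open>
  The error is compared with the limiting cost at the moving point \<open>\<sigma> n\<close>, not at \<open>\<tau>\<close>, so that
  the expansion holds for every sequence with limit \<open>\<tau>\<close>, however slowly it converges.
\<close>

lemma scaled_cost_expansion:
  fixes r \<sigma> :: "nat \<Rightarrow> real"
  assumes r: "filterlim r at_top sequentially" and \<sigma>: "\<sigma> \<longlonglongrightarrow> \<tau>" and \<tau>: "\<tau> > 0"
  shows "(\<lambda>n. r n * (scaled_cost h c (r n) (\<sigma> n) - limit_cost h c (\<sigma> n))) \<longlonglongrightarrow> - h * corr_integral \<tau> / (\<tau> * (lim_integral \<tau> * lim_integral \<tau>))"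
proof -
  have J0: "lim_integral \<tau> \<noteq> 0" and \<tau>0: "\<tau> \<noteq> 0" using lim_integral_ge_1[of \<tau>] \<tau> by auto
  have Jl: "(\<lambda>n. lim_integral (\<sigma> n)) \<longlonglongrightarrow> lim_integral \<tau>" by (rule isCont_tendsto_compose[OF lim_integral_cont \<sigma>])
  note Jrl = pre_integral_tendsto[OF r \<sigma>]
  have "(\<lambda>n. - h * (r n * (pre_integral (r n) (\<sigma> n) - lim_integral (\<sigma> n))) / (\<sigma> n * (pre_integral (r n) (\<sigma> n) * lim_integral (\<sigma> n))))
      \<longlonglongrightarrow> - h * corr_integral \<tau> / (\<tau> * (lim_integral \<tau> * lim_integral \<tau>))"
    by (intro tendsto_intros pre_integral_expansion r \<sigma> Jl Jrl) (use \<tau> J0 in auto)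
  moreover have "\<forall>\<^sub>F n in sequentially.
      - h * (r n * (pre_integral (r n) (\<sigma> n) - lim_integral (\<sigma> n))) / (\<sigma> n * (pre_integral (r n) (\<sigma> n) * lim_integral (\<sigma> n)))
      = r n * (scaled_cost h c (r n) (\<sigma> n) - limit_cost h c (\<sigma> n))"
    using tendsto_imp_eventually_ne[OF Jl J0] tendsto_imp_eventually_ne[OF Jrl J0]
      tendsto_imp_eventually_ne[OF \<sigma> \<tau>0]
    by eventually_elim (simp_all add: scaled_cost_def limit_cost_def q_eq divide_simps, simp_all add: algebra_simps)
  ultimately show ?thesis by (simp add: tendsto_cong)
qed

lemma scaled_cost_tendsto:
  fixes r \<sigma> :: "nat \<Rightarrow> real"
  assumes r: "filterlim r at_top sequentially" and \<sigma>: "\<sigma> \<longlonglongrightarrow> \<tau>" and \<tau>: "\<tau> > 0"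
  shows "(\<lambda>n. scaled_cost h c (r n) (\<sigma> n)) \<longlonglongrightarrow> limit_cost h c \<tau>"
proof -
  have "lim_integral \<tau> \<noteq> 0" using lim_integral_ge_1[of \<tau>] \<tau> by auto
  then have "(\<lambda>n. scaled_cost h c (r n) (\<sigma> n)) \<longlonglongrightarrow> h / (\<tau> * lim_integral \<tau>) + c * \<tau>"
    unfolding scaled_cost_def using \<tau> by (intro tendsto_intros pre_integral_tendsto r \<sigma>) auto
  then show ?thesis by (simp add: limit_cost_def q_eq)
qed

text \<open>
  The scaled cost bounds \<open>c * \<sigma>\<close>, so a sequence that does not converge to \<open>\<tau>\<close> has a subsequence
  with another limit. Along it the scaled cost is unbounded if this limit is \<open>0\<close>, and otherwise the
  limit is a second minimizer of the limiting cost.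
\<close>

lemma near_minimizers_converge:
  fixes r \<sigma> m :: "nat \<Rightarrow> real"
  assumes st: "is_sigma_star h c \<tau>" and h: "h > 0" and c: "c > 0"
    and r: "filterlim r at_top sequentially"
    and pos: "\<And>n. \<sigma> n > 0" 
    and le: "\<And>n. scaled_cost h c (r n) (\<sigma> n) \<le> m n"
    and m: "m \<longlonglongrightarrow> limit_cost h c \<tau>"
  shows "\<sigma> \<longlonglongrightarrow> \<tau>"
proof (rule ccontr)
  assume "\<not> \<sigma> \<longlonglongrightarrow> \<tau>"
  then obtain e where e: "e > 0" "\<not> (\<forall>\<^sub>F n in sequentially. dist (\<sigma> n) \<tau> < e)"
    unfolding tendsto_iff by blast
  obtain M where M: "\<And>n. \<bar>m n\<bar> \<le> M"
    using convergent_imp_Bseq[OF convergentI[OF m]] by (auto simp: Bseq_def)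
  have pre_integral_nonneg: "pre_integral r \<sigma> \<ge> 0" for r \<sigma>
    unfolding pre_integral_def set_lebesgue_integral_def by (intro integral_nonneg_AE AE_I2) (auto simp: indicator_def)
  have bdd: "\<sigma> n \<in> {0..M / c}" for n
  proof -
    have "c * \<sigma> n \<le> scaled_cost h c (r n) (\<sigma> n)"
      using h pos[of n] pre_integral_nonneg[of "r n" "\<sigma> n"] by (simp add: scaled_cost_def)
    also have "\<dots> \<le> M" using le[of n] M[of n] by linarith
    finally show ?thesis using c pos[of n] by (simp add: field_simps)
  qed
  obtain k1 :: "nat \<Rightarrow> nat" where k1: "strict_mono k1" "\<And>n. dist (\<sigma> (k1 n)) \<tau> \<ge> e"
    using not_eventually_sequentiallyD[OF e(2)] by (auto simp: not_less)
  obtain \<tau>' k2 where k2: "\<tau>' \<in> {0..M / c}" "strict_mono k2" "((\<lambda>n. \<sigma> (k1 n)) \<circ> k2) \<longlonglongrightarrow> \<tau>'"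
    using seq_compactE[OF compact_imp_seq_compact[OF compact_Icc[of 0 "M / c"]], of "\<lambda>n. \<sigma> (k1 n)"] bdd by blast
  define k where "k = k1 \<circ> k2"
  have k: "strict_mono k" using k1(1) k2(2) unfolding k_def by (rule strict_mono_o)
  have \<sigma>k: "(\<lambda>n. \<sigma> (k n)) \<longlonglongrightarrow> \<tau>'" using k2(3) by (simp add: k_def o_def)
  have rk: "filterlim (\<lambda>n. r (k n)) at_top sequentially"
    by (rule filterlim_compose[OF r filterlim_subseq[OF k]])
  have mk: "(\<lambda>n. m (k n)) \<longlonglongrightarrow> limit_cost h c \<tau>"
    using LIMSEQ_subseq_LIMSEQ[OF m k] by (simp add: o_def)
  have ne: "\<tau>' \<noteq> \<tau>"
  proof
    assume "\<tau>' = \<tau>"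
    have "e \<le> dist \<tau>' \<tau>"
      by (rule tendsto_lowerbound[OF tendsto_dist[OF \<sigma>k tendsto_const]]) (auto simp: k_def k1(2))
    with e \<open>\<tau>' = \<tau>\<close> show False by simp
  qed
  show False
  proof (cases "\<tau>' = 0")
    case True
    have J0: "lim_integral 0 = 1" by (simp add: lim_integral_eq)
    have "(\<lambda>n. \<sigma> (k n) * pre_integral (r (k n)) (\<sigma> (k n))) \<longlonglongrightarrow> \<tau>' * lim_integral \<tau>'"
      by (intro tendsto_mult \<sigma>k pre_integral_tendsto rk)
    then have z: "(\<lambda>n. \<sigma> (k n) * pre_integral (r (k n)) (\<sigma> (k n))) \<longlonglongrightarrow> 0" using True by simp
    have "h \<le> M * (\<sigma> (k n) * pre_integral (r (k n)) (\<sigma> (k n)))" if Jpos: "pre_integral (r (k n)) (\<sigma> (k n)) > 0" for n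
    proof -
      have "h / (\<sigma> (k n) * pre_integral (r (k n)) (\<sigma> (k n))) \<le> scaled_cost h c (r (k n)) (\<sigma> (k n))"
        using c pos[of "k n"] by (simp add: scaled_cost_def)
      also have "\<dots> \<le> M" using le[of "k n"] M[of "k n"] by linarith
      finally show ?thesis using Jpos pos[of "k n"] by (simp add: field_simps)
    qed
    moreover have "\<forall>\<^sub>F n in sequentially. pre_integral (r (k n)) (\<sigma> (k n)) > 0"
      by (rule order_tendstoD(1)[OF pre_integral_tendsto[OF rk \<sigma>k]]) (simp add: True J0)
    ultimately have "\<forall>\<^sub>F n in sequentially. h \<le> M * (\<sigma> (k n) * pre_integral (r (k n)) (\<sigma> (k n)))"
      by (auto elim: eventually_mono)
    then have "h \<le> M * 0" by (intro tendsto_lowerbound[OF tendsto_mult[OF tendsto_const z]]) auto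
    then show False using h by simp
  next
    case False
    then have \<tau>': "\<tau>' > 0" using k2(1) by auto
    have "limit_cost h c \<tau>' \<le> limit_cost h c \<tau>"
      by (rule LIMSEQ_le[OF scaled_cost_tendsto[OF rk \<sigma>k \<tau>'] mk]) (auto intro: le)
    then have "is_sigma_star h c \<tau>'"
      using st \<tau>' by (force simp: is_sigma_star_iff)
    then show False using ex1_is_sigma_star[OF h c] st ne by blast
  qed
qed

section \<open>Staffing levels and the optimal cost\<close>

text \<open>
  The cost at a perturbed square-root staffing level, known up to \<open>o(1)\<close>. All
  perturbations \<open>\<delta>\<close> lead to the same limit, which makes them interchangeable.
\<close>

lemma staffing_cost_tendsto:
  fixes r \<delta> :: "nat \<Rightarrow> real"
  assumes st: "is_sigma_star h c \<tau>" and mu: "mu > 0"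
    and r: "filterlim r at_top sequentially"
    and \<delta>: "(\<lambda>n. \<delta> n / sqrt (r n)) \<longlonglongrightarrow> 0"
  shows "(\<lambda>n. \<tau> + \<delta> n / r n) \<longlonglongrightarrow> \<tau>"
    and "(\<lambda>n. cost h c mu ((r n)\<^sup>2 * mu) ((r n)\<^sup>2 + \<tau> * r n + \<delta> n) - (c * (r n)\<^sup>2 + r n * limit_cost h c \<tau>))
      \<longlonglongrightarrow> - h * corr_integral \<tau> / (\<tau> * (lim_integral \<tau> * lim_integral \<tau>))"
proof -
  have \<tau>: "\<tau> > 0" using st by (simp add: is_sigma_star_iff)
  have rpos: "\<forall>\<^sub>F n in sequentially. r n > 0"
    using filterlim_at_top_dense[THEN iffD1, OF r, rule_format, of 0] .
  define \<sigma> where "\<sigma> = (\<lambda>n. \<tau> + \<delta> n / r n)"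
  have "(\<lambda>n. \<tau> + \<delta> n / sqrt (r n) * inverse (sqrt (r n))) \<longlonglongrightarrow> \<tau> + 0 * 0"
    by (intro tendsto_intros \<delta> tendsto_inverse_0_at_top filterlim_compose[OF sqrt_at_top r])
  moreover have "\<forall>\<^sub>F n in sequentially. \<tau> + \<delta> n / sqrt (r n) * inverse (sqrt (r n)) = \<sigma> n"
    using rpos by eventually_elim (simp add: \<sigma>_def field_simps)
  ultimately have \<sigma>: "\<sigma> \<longlonglongrightarrow> \<tau>" by (simp add: tendsto_cong)
  then show "(\<lambda>n. \<tau> + \<delta> n / r n) \<longlonglongrightarrow> \<tau>" by (simp add: \<sigma>_def)
  have "(\<lambda>n. (\<delta> n / sqrt (r n))\<^sup>2) \<longlonglongrightarrow> 0\<^sup>2" by (intro tendsto_intros \<delta>)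
  moreover have "\<forall>\<^sub>F n in sequentially. (\<delta> n / sqrt (r n))\<^sup>2 = r n * (\<sigma> n - \<tau>)\<^sup>2"
    using rpos by eventually_elim (simp add: \<sigma>_def power_divide power2_eq_square)
  ultimately have small: "(\<lambda>n. r n * (\<sigma> n - \<tau>)\<^sup>2) \<longlonglongrightarrow> 0" by (simp add: tendsto_cong)
  have "(\<lambda>n. r n * (scaled_cost h c (r n) (\<sigma> n) - limit_cost h c (\<sigma> n))
      + r n * (limit_cost h c (\<sigma> n) - limit_cost h c \<tau>)) \<longlonglongrightarrow> - h * corr_integral \<tau> / (\<tau> * (lim_integral \<tau> * lim_integral \<tau>)) + 0"
    by (intro tendsto_add scaled_cost_expansion limit_cost_quadratic[OF st] r \<sigma> \<tau> rpos small)
  moreover have "\<forall>\<^sub>F n in sequentially. r n * (scaled_cost h c (r n) (\<sigma> n) - limit_cost h c (\<sigma> n))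
      + r n * (limit_cost h c (\<sigma> n) - limit_cost h c \<tau>) =
      cost h c mu ((r n)\<^sup>2 * mu) ((r n)\<^sup>2 + \<tau> * r n + \<delta> n) - (c * (r n)\<^sup>2 + r n * limit_cost h c \<tau>)"
    using rpos order_tendstoD(1)[OF \<sigma> \<tau>]
  proof eventually_elim
    case (elim n)
    have "(r n)\<^sup>2 + \<tau> * r n + \<delta> n = (r n)\<^sup>2 + \<sigma> n * r n" using elim by (simp add: \<sigma>_def field_simps)
    then show ?case
      by (simp only: cost_eq_scaled_cost[OF elim mu]) (simp add: algebra_simps)
  qed
  ultimately show "(\<lambda>n. cost h c mu ((r n)\<^sup>2 * mu) ((r n)\<^sup>2 + \<tau> * r n + \<delta> n) - (c * (r n)\<^sup>2 + r n * limit_cost h c \<tau>))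
      \<longlonglongrightarrow> - h * corr_integral \<tau> / (\<tau> * (lim_integral \<tau> * lim_integral \<tau>))" by (simp add: tendsto_cong)
qed

lemma optimal_cost_le:
  assumes "h > 0" "c > 0" "mu > 0" "lam > 0" "real s > lam / mu"
  shows "optimal_cost h c mu lam \<le> cost h c mu lam (real s)"
proof -
  have "mms_queue_length lam mu s \<ge> 0" for s
    unfolding mms_queue_length_def by (intro integral_nonneg_AE) auto
  then have "bdd_below ((\<lambda>s. h * mms_queue_length lam mu s + c * real s) ` {s. real s > lam / mu})"
    using assms by (intro bdd_belowI2[of _ 0]) auto
  then have "optimal_cost h c mu lam \<le> h * mms_queue_length lam mu s + c * real s"
    unfolding optimal_cost_def using assms by (intro cINF_lower) auto
  then show ?thesis using assms by (simp add: cost_def mms_queue_length_eq_queue_length)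
qed

lemma optimal_cost_approx:
  assumes "mu > 0" "lam > 0" "e > 0"
  obtains s where "real s > lam / mu" "cost h c mu lam (real s) \<le> optimal_cost h c mu lam + e"
proof -
  let ?A = "(\<lambda>s. h * mms_queue_length lam mu s + c * real s) ` {s. real s > lam / mu}"
  have ne: "?A \<noteq> {}" using reals_Archimedean2[of "lam / mu"] by blast
  have "Inf ?A < optimal_cost h c mu lam + e" using assms(3) by (simp add: optimal_cost_def)
  from cInf_lessD[OF ne this] obtain s where s: "real s > lam / mu"
      "h * mms_queue_length lam mu s + c * real s < optimal_cost h c mu lam + e"
    by auto
  show ?thesis
  proof (rule that[OF s(1)])
    show "cost h c mu lam (real s) \<le> optimal_cost h c mu lam + e"
      using s(2) unfolding cost_def mms_queue_length_eq_queue_length[OF assms(2,1) s(1)] by simp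
  qed
qed

text \<open>
  The optimal cost lies between that of the rounded-up square-root staffing level and, up to
  \<open>1 / (n + 1)\<close>, that of the near-optimal integers \<open>k n\<close>. Relative to the common leading terms, the
  first tends to the same limit as the cost at the perturbed level, and the second is bounded below
  by a sequence with this limit.
\<close>

lemma staffing_gap_tendsto_0:
  fixes r \<delta> :: "nat \<Rightarrow> real"
  assumes st: "is_sigma_star h c \<tau>" and h: "h > 0" and c: "c > 0" and mu: "mu > 0"
    and r: "filterlim r at_top sequentially" and rpos: "\<And>n. r n > 0"
    and \<delta>: "(\<lambda>n. \<delta> n / sqrt (r n)) \<longlonglongrightarrow> 0"
  shows "(\<lambda>n. cost h c mu ((r n)\<^sup>2 * mu) ((r n)\<^sup>2 + \<tau> * r n + \<delta> n) - optimal_cost h c mu ((r n)\<^sup>2 * mu)) \<longlonglongrightarrow> 0"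
proof -
  define L where "L = - h * corr_integral \<tau> / (\<tau> * (lim_integral \<tau> * lim_integral \<tau>))"
  define base where "base = (\<lambda>n. c * (r n)\<^sup>2 + r n * limit_cost h c \<tau>)"
  define opt where "opt = (\<lambda>n. optimal_cost h c mu ((r n)\<^sup>2 * mu))"
  define cst where "cst = (\<lambda>n s. cost h c mu ((r n)\<^sup>2 * mu) s)"
  have \<tau>: "\<tau> > 0" and min: "\<And>x. x > 0 \<Longrightarrow> limit_cost h c \<tau> \<le> limit_cost h c x"
    using st by (auto simp: is_sigma_star_iff)
  have lam: "(r n)\<^sup>2 * mu > 0" "(r n)\<^sup>2 * mu / mu = (r n)\<^sup>2" for n using rpos[of n] mu by simp_all
  have cst: "cst n ((r n)\<^sup>2 + \<sigma> * r n) = c * (r n)\<^sup>2 + r n * scaled_cost h c (r n) \<sigma>" if "\<sigma> > 0" for n \<sigma>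
    unfolding cst_def by (rule cost_eq_scaled_cost[OF rpos that mu])

  \<comment> \<open>Rounding up moves the square-root staffing level by at most \<open>1\<close> and keeps it feasible.\<close>
  define k0 where "k0 = (\<lambda>n. nat \<lceil>(r n)\<^sup>2 + \<tau> * r n\<rceil>)"
  define \<delta>0 where "\<delta>0 = (\<lambda>n. real (k0 n) - ((r n)\<^sup>2 + \<tau> * r n))"
  have k0: "real (k0 n) = of_int \<lceil>(r n)\<^sup>2 + \<tau> * r n\<rceil>" for n
    using rpos[of n] \<tau> by (simp add: k0_def add_nonneg_nonneg)
  have \<delta>0: "0 \<le> \<delta>0 n" "\<delta>0 n \<le> 1" for n unfolding \<delta>0_def k0 by linarith+
  have k0_eq: "real (k0 n) = (r n)\<^sup>2 + \<tau> * r n + \<delta>0 n" for n by (simp add: \<delta>0_def)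
  have k0_gt: "real (k0 n) > (r n)\<^sup>2" for n
    using \<delta>0(1)[of n] mult_pos_pos[OF \<tau> rpos[of n]] unfolding k0_eq by linarith
  have isr: "(\<lambda>n. inverse (sqrt (r n))) \<longlonglongrightarrow> 0"
    by (intro tendsto_inverse_0_at_top filterlim_compose[OF sqrt_at_top r])
  have \<delta>0_lim: "(\<lambda>n. \<delta>0 n / sqrt (r n)) \<longlonglongrightarrow> 0"
  proof (rule tendsto_sandwich[OF _ _ tendsto_const isr])
    show "\<forall>\<^sub>F n in sequentially. 0 \<le> \<delta>0 n / sqrt (r n)"
      using \<delta>0 rpos by (intro always_eventually allI divide_nonneg_nonneg) (simp_all add: less_imp_le)
    show "\<forall>\<^sub>F n in sequentially. \<delta>0 n / sqrt (r n) \<le> inverse (sqrt (r n))"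
      using \<delta>0 rpos by (intro always_eventually allI) (simp add: divide_simps less_imp_le)
  qed
  note T0 = staffing_cost_tendsto[OF st mu r \<delta>0_lim] and T = staffing_cost_tendsto[OF st mu r \<delta>]
  have opt_le: "opt n \<le> cst n (real (k0 n))" for n
    unfolding opt_def cst_def using h c mu lam k0_gt by (intro optimal_cost_le) simp_all

  \<comment> \<open>The integers \<open>k n\<close> come within \<open>1 / (n + 1)\<close> of the infimum.\<close>
  have "\<exists>k. real k > (r n)\<^sup>2 \<and> cst n (real k) \<le> opt n + inverse (Suc n)" for n
    using optimal_cost_approx[OF mu lam(1), of "inverse (Suc n)" n h c] unfolding lam cst_def opt_def by auto
  then obtain k where k: "\<And>n. real (k n) > (r n)\<^sup>2" "\<And>n. cst n (real (k n)) \<le> opt n + inverse (Suc n)"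
    by metis
  define \<sigma> where "\<sigma> = (\<lambda>n. (real (k n) - (r n)\<^sup>2) / r n)"
  have \<sigma>pos: "\<sigma> n > 0" for n using k(1) rpos by (simp add: \<sigma>_def)
  have k_eq: "real (k n) = (r n)\<^sup>2 + \<sigma> n * r n" for n using rpos[of n] by (simp add: \<sigma>_def)
  define \<sigma>0 where "\<sigma>0 = (\<lambda>n. \<tau> + \<delta>0 n / r n)"
  have \<sigma>0pos: "\<sigma>0 n > 0" for n using \<tau> \<delta>0(1)[of n] rpos[of n] by (simp add: \<sigma>0_def add_pos_nonneg)
  have k0_eq': "real (k0 n) = (r n)\<^sup>2 + \<sigma>0 n * r n" for n using rpos[of n] by (simp add: k0_eq \<sigma>0_def distrib_right)
  have \<sigma>_lim: "\<sigma> \<longlonglongrightarrow> \<tau>"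
  proof (rule near_minimizers_converge[OF st h c r \<sigma>pos])
    show "scaled_cost h c (r n) (\<sigma> n) \<le> scaled_cost h c (r n) (\<sigma>0 n) + inverse (r n)" for n
    proof -
      have "r n * scaled_cost h c (r n) (\<sigma> n) \<le> r n * scaled_cost h c (r n) (\<sigma>0 n) + inverse (Suc n)"
        using k(2)[of n] opt_le[of n] unfolding k_eq k0_eq' cst[OF \<sigma>pos] cst[OF \<sigma>0pos] by linarith
      also have "inverse (real (Suc n)) \<le> r n * inverse (r n)" using rpos[of n] by (simp add: divide_simps)
      finally have "r n * scaled_cost h c (r n) (\<sigma> n) \<le> r n * (scaled_cost h c (r n) (\<sigma>0 n) + inverse (r n))"
        by (simp add: distrib_left)
      then show ?thesis using rpos[of n] by simp
    qed
    have "(\<lambda>n. scaled_cost h c (r n) (\<sigma>0 n) + inverse (r n)) \<longlonglongrightarrow> limit_cost h c \<tau> + 0"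
      unfolding \<sigma>0_def by (intro tendsto_add scaled_cost_tendsto r T0(1) \<tau> tendsto_inverse_0_at_top)
    then show "(\<lambda>n. scaled_cost h c (r n) (\<sigma>0 n) + inverse (r n)) \<longlonglongrightarrow> limit_cost h c \<tau>" by simp
  qed
  define A where "A = (\<lambda>n. r n * (scaled_cost h c (r n) (\<sigma> n) - limit_cost h c (\<sigma> n)))"
  have A: "A \<longlonglongrightarrow> L" unfolding A_def L_def by (rule scaled_cost_expansion[OF r \<sigma>_lim \<tau>])
  \<comment> \<open>Replacing \<open>limit_cost h c (\<sigma> n)\<close> by its minimum gives a lower bound whatever the rate at which \<open>\<sigma>\<close> tends to \<open>\<tau>\<close>.\<close>
  have A_le: "A n \<le> cst n (real (k n)) - base n" for n
  proof -
    have "r n * limit_cost h c \<tau> \<le> r n * limit_cost h c (\<sigma> n)"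
      using rpos[of n] min[OF \<sigma>pos[of n]] by simp
    then show ?thesis unfolding k_eq cst[OF \<sigma>pos] A_def base_def by (simp add: right_diff_distrib)
  qed
  define B where "B = (\<lambda>n. cst n ((r n)\<^sup>2 + \<tau> * r n + \<delta> n) - base n)"
  define B0 where "B0 = (\<lambda>n. cst n (real (k0 n)) - base n)"
  have B: "B \<longlonglongrightarrow> L" using T(2) by (simp add: B_def L_def cst_def base_def)
  have B0: "B0 \<longlonglongrightarrow> L" using T0(2) by (simp add: B0_def L_def cst_def base_def k0_eq)
  have "(\<lambda>n. B n + base n - opt n) \<longlonglongrightarrow> 0"
  proof (rule tendsto_sandwich)
    show "\<forall>\<^sub>F n in sequentially. B n - B0 n \<le> B n + base n - opt n"
      using opt_le by (intro always_eventually allI) (simp add: B0_def)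
    show "\<forall>\<^sub>F n in sequentially. B n + base n - opt n \<le> B n - A n + inverse (real (Suc n))"
    proof (intro always_eventually allI)
      fix n
      show "B n + base n - opt n \<le> B n - A n + inverse (real (Suc n))"
        using k(2)[of n] A_le[of n] by linarith
    qed
    show "(\<lambda>n. B n - B0 n) \<longlonglongrightarrow> 0" using tendsto_diff[OF B B0] by simp
    show "(\<lambda>n. B n - A n + inverse (real (Suc n))) \<longlonglongrightarrow> 0"
      using tendsto_add[OF tendsto_diff[OF B A] LIMSEQ_inverse_real_of_nat] by simp
  qed
  then show ?thesis by (simp add: B_def cst_def opt_def)
qed

theorem theorem1:
  fixes h c mu :: real
  assumes "h > 0" and "c > 0" and "mu > 0"
  shows "(\<exists>!\<sigma>. is_sigma_star h c \<sigma>) \<and>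
    (\<forall>\<eta> :: real \<Rightarrow> real. \<eta> \<in> o[at_top](\<lambda>lam. lam powr (1/4)) \<longrightarrow>
      ((\<lambda>lam. cost h c mu lam (s_bar h c mu lam + \<eta> lam) - optimal_cost h c mu lam)
         \<longlongrightarrow> 0) at_top)"
proof (intro conjI allI impI)
  show "\<exists>!\<sigma>. is_sigma_star h c \<sigma>" by (rule ex1_is_sigma_star[OF assms(1,2)])
next
  fix \<eta> :: "real \<Rightarrow> real"
  assume "\<eta> \<in> o[at_top](\<lambda>lam. lam powr (1/4))"
  then have \<eta>: "((\<lambda>lam. \<eta> lam / lam powr (1/4)) \<longlongrightarrow> 0) at_top" by (rule smalloD_tendsto)
  show "((\<lambda>lam. cost h c mu lam (s_bar h c mu lam + \<eta> lam) - optimal_cost h c mu lam) \<longlongrightarrow> 0) at_top"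
  proof (rule tendsto_at_topI_sequentially)
    fix X :: "nat \<Rightarrow> real" assume X: "filterlim X at_top sequentially"
    then obtain N where N: "\<And>n. n \<ge> N \<Longrightarrow> X n > 0"
      using filterlim_at_top_dense[THEN iffD1, OF X, rule_format, of 0] unfolding eventually_sequentially by blast
    define Y where "Y = (\<lambda>n. X (n + N))"
    have Y: "filterlim Y at_top sequentially" "Y n > 0" for n
      unfolding Y_def by (rule filterlim_compose[OF X filterlim_add_const_nat_at_top], rule N, simp)
    define r where "r = (\<lambda>n. sqrt (Y n / mu))"
    have r2: "(r n)\<^sup>2 = Y n / mu" and cancel: "Y n / mu * mu = Y n" for n
      using Y(2)[of n] assms(3) by (simp_all add: r_def)
    have rpos: "r n > 0" for n using Y(2)[of n] assms(3) by (simp add: r_def)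
    have "filterlim (\<lambda>n. inverse mu * Y n) at_top sequentially"
      by (rule filterlim_tendsto_pos_mult_at_top[OF tendsto_const _ Y(1)]) (use assms(3) in simp)
    then have "filterlim (\<lambda>n. Y n / mu) at_top sequentially" by (simp add: field_simps)
    then have r: "filterlim r at_top sequentially"
      unfolding r_def by (intro filterlim_compose[OF sqrt_at_top])
    \<comment> \<open>The growth condition on \<open>\<eta>\<close> in terms of \<open>r\<close>: \<open>sqrt r\<close> is a constant multiple of \<open>lam powr (1/4)\<close>.\<close>
    have sqrt_r: "sqrt (r n) = Y n powr (1/4) / mu powr (1/4)" for n
      using Y(2)[of n] assms(3)
      by (simp add: r_def powr_half_sqrt[symmetric] powr_powr powr_divide)
    have "(\<lambda>n. \<eta> (Y n) / Y n powr (1/4) * mu powr (1/4)) \<longlonglongrightarrow> 0 * mu powr (1/4)"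
      by (intro tendsto_mult filterlim_compose[OF \<eta> Y(1)] tendsto_const)
    then have "(\<lambda>n. \<eta> (Y n) / sqrt (r n)) \<longlonglongrightarrow> 0" by (simp add: sqrt_r)
    from staffing_gap_tendsto_0[OF is_sigma_star_sigma_star[OF assms(1,2)] assms r rpos this]
    have "(\<lambda>n. cost h c mu (Y n) (s_bar h c mu (Y n) + \<eta> (Y n)) - optimal_cost h c mu (Y n)) \<longlonglongrightarrow> 0"
      unfolding r2 cancel s_bar_def by (simp only: r_def)
    then show "(\<lambda>n. cost h c mu (X n) (s_bar h c mu (X n) + \<eta> (X n)) - optimal_cost h c mu (X n)) \<longlonglongrightarrow> 0"
      unfolding Y_def by (rule LIMSEQ_offset)
  qed
qed

end
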